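(* For $0<p<1$, let $\mathcal A\subseteq\mathbb Z_{>0}$ be a random subset in which each positive integer is included independently with probability $p$, and let $\langle\mathcal A\rangle$ be the numerical semigroup generated by $\mathcal A$. There exist absolute constants $0<c<C$ and $p_0\in(0,1)$ such that the following two statements hold. (1) As $p\to0$, the probability that all of the following inequalities hold simultaneously tends to $1$: $$c\,p^{-1}(\log p^{-1})^2\le g(\langle\mathcal A\rangle)\le C\,p^{-1}(\log p^{-1})^2,$$ $$c\,p^{-1}(\log p^{-1})^2\le F(\langle\mathcal A\rangle)\le C\,p^{-1}(\log p^{-1})^2,$$ $$c\,(\log p^{-1})^2\le e(\langle\mathcal A\rangle)\le C\,(\log p^{-1})^2.$$ (2) For all $0<p<p_0$, $$c\,p^{-1}(\log p^{-1})^2\le \mathbb E\big(g(\langle\mathcal A\rangle)\big)\le C\,p^{-1}(\log p^{-1})^2,$$ $$c\,p^{-1}(\log p^{-1})^2\le \mathbb E\big(F(\langle\mathcal A\rangle)\big)\le C\,p^{-1}(\log p^{-1})^2,$$ $$c\,(\log p^{-1})^2\le \mathbb E\big(e(\langle\mathcal A\rangle)\big)\le C\,(\log p^{-1})^2.$$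
   Context: A numerical semigroup is a co-finite subset of $\mathbb Z_{\ge0}$ that contains $0$ and is closed under addition. For $\mathcal A\subseteq\mathbb Z_{>0}$, $\langle\mathcal A\rangle:=\{a_1+\cdots+a_k:\ k\ge0,\ a_1,\dots,a_k\in\mathcal A\}$ (repetitions allowed; the empty sum is $0$). For the random set $\mathcal A$, with probability $1$ it contains two consecutive integers, so $\langle\mathcal A\rangle$ is almost surely a numerical semigroup. For a numerical semigroup $\mathcal S$: the Frobenius number is $F(\mathcal S):=\sup(\mathbb Z_{>0}\setminus\mathcal S)$, with the convention $F(\mathbb Z_{\ge0}):=-1$; the genus is $g(\mathcal S):=|\mathbb Z_{>0}\setminus\mathcal S|$; the embedding dimension is $e(\mathcal S):=\min\{|\mathcal B|:\ \mathcal B\subseteq \mathbb Z_{>0},\ \langle\mathcal B\rangle=\mathcal S\}$. Logarithms are natural. *)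

theory Defs
  imports "HOL-Probability.Probability"
begin

definition semigroup_span :: "nat set \<Rightarrow> nat set" where
  "semigroup_span A = {sum_list xs |xs. set xs \<subseteq> A}"

text \<open>
  The three invariants below are total functions on sets of naturals. They have their usual meaning
  when the argument is a numerical semigroup (cofinite, containing 0, closed under addition); for a
  set with infinitely many gaps the values of the first two are meaningless. A random set as below
  almost surely spans a numerical semigroup, so these values affect neither the probabilities nor
  the expectations.
\<close>

definition genus :: "nat set \<Rightarrow> nat" where
  "genus S = card ({0<..} - S)"

definition frobenius :: "nat set \<Rightarrow> int" where
  "frobenius S = (if S = UNIV then - 1 else int (Sup ({0<..} - S)))"

text \<open>
  Since \<^const>\<open>card\<close> is 0 on infinite sets, the generating sets have to be restricted to finite ones.
  Every numerical semigroup has a finite generating set, so the minimum is unchanged.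
\<close>

definition embedding_dim :: "nat set \<Rightarrow> nat" where
  "embedding_dim S = (LEAST k. \<exists>B. finite B \<and> B \<subseteq> {0<..} \<and> semigroup_span B = S \<and> card B = k)"

text \<open>
  A sample point is a family of independent Bernoulli variables with parameter \<open>p\<close>, one for each
  positive integer \<open>n\<close>, which decides whether \<open>n\<close> belongs to the random set.
\<close>

definition bernoulli_space :: "real \<Rightarrow> (nat \<Rightarrow> bool) measure" where
  "bernoulli_space p = PiM {0<..} (\<lambda>_. measure_pmf (bernoulli_pmf p))"

definition random_set :: "(nat \<Rightarrow> bool) \<Rightarrow> nat set" where
  "random_set \<omega> = {n. 0 < n \<and> \<omega> n}"

definition random_semigroup :: "(nat \<Rightarrow> bool) \<Rightarrow> nat set" where
  "random_semigroup \<omega> = semigroup_span (random_set \<omega>)"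

lemma prob_space_bernoulli_space: "prob_space (bernoulli_space p)"
  unfolding bernoulli_space_def by (intro prob_space_PiM measure_pmf.prob_space_axioms)

end

theory Submission
  imports Defs "HOL-Real_Asymp.Real_Asymp"
begin

text \<open>
  Write \<open>L = ln (1 / p)\<close>, let \<open>A\<close> be the random set and \<open>S\<close> its span.

  Lower bounds. For \<open>0 < x < 1\<close> the number of elements of \<open>S\<close> up to \<open>N\<close> is at most \<open>x\<close> to the power \<open>-N\<close>
  times the product of \<open>1 / (1 - x\<^sup>a)\<close> over \<open>a \<in> A\<close>. The expectation of this product is too large, because
  of rare small elements of \<open>A\<close>, but the expectation of its square root is at most \<open>exp (2p / (1 - x))\<close>.
  With \<open>1 - x = 16p / L\<close> and \<open>N = L\<^sup>2 / (128p)\<close> it follows that \<open>S\<close> contains only \<open>o(N)\<close> of the numbers up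
  to \<open>N\<close>, in expectation. So most of these are gaps, and since \<open>a \<in> A\<close> is independent of the elements
  of \<open>A\<close> below \<open>a\<close>, most of the about \<open>pN\<close> elements of \<open>A\<close> up to \<open>N\<close> are minimal generators.

  Upper bounds. Fix a modulus \<open>m\<close>. If \<open>H\<close> is the set of subset sums modulo \<open>m\<close> of the elements chosen so
  far and \<open>x\<close> is uniform modulo \<open>m\<close>, then replacing \<open>H\<close> by \<open>H \<union> (H + x)\<close> halves the expectation of
  \<open>m / |H| - 1\<close>. So a constant times \<open>L\<close> elements of \<open>A\<close> up to \<open>R = O(L / p)\<close> have subset sums in every
  residue class, outside an event so rare that it can be summed over all \<open>m \<le> R\<close>. Taking \<open>m \<in> A\<close>, all
  numbers from \<open>O(L R) = O(L\<^sup>2 / p)\<close> on lie in \<open>S\<close>, and no minimal generator is larger. The same argument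
  with \<open>(j + 1) L\<close> in place of \<open>L\<close> gives the tails needed for the expectations.
\<close>

section \<open>Generating sets of submonoids of the natural numbers\<close>

lemma span_sum_list_subset: "set xs \<subseteq> A \<Longrightarrow> sum_list xs \<in> semigroup_span A"
  unfolding semigroup_span_def by blast

lemma span_zero [simp]: "0 \<in> semigroup_span A"
  using span_sum_list_subset[of "[]" A] by simp

lemma span_base: "a \<in> A \<Longrightarrow> a \<in> semigroup_span A"
  using span_sum_list_subset[of "[a]" A] by simp

lemma span_add: "a \<in> semigroup_span A \<Longrightarrow> b \<in> semigroup_span A \<Longrightarrow> a + b \<in> semigroup_span A"
proof -
  assume "a \<in> semigroup_span A" "b \<in> semigroup_span A"
  then obtain xs ys where "a = sum_list xs" "b = sum_list ys" "set xs \<subseteq> A" "set ys \<subseteq> A"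
    unfolding semigroup_span_def by blast
  then show ?thesis
    using span_sum_list_subset[of "xs @ ys" A] by simp
qed

lemma span_mult: "a \<in> semigroup_span A \<Longrightarrow> j * a \<in> semigroup_span A"
  by (induction j) (auto intro: span_add)

lemma span_sum_list: "set xs \<subseteq> semigroup_span A \<Longrightarrow> sum_list xs \<in> semigroup_span A"
  by (induction xs) (auto intro: span_add)

lemma span_least: "A \<subseteq> semigroup_span B \<Longrightarrow> semigroup_span A \<subseteq> semigroup_span B"
  using span_sum_list unfolding semigroup_span_def[of A] by blast

lemma span_mono: "A \<subseteq> B \<Longrightarrow> semigroup_span A \<subseteq> semigroup_span B"
  by (rule span_least) (auto intro: span_base)

lemma span_empty: "semigroup_span {} = {0}"
  unfolding semigroup_span_def by auto

text \<open>No summand of a sum of naturals exceeds the sum. This locality turns membership in the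
  random semigroup into an event about finitely many coordinates.\<close>

lemma span_atMost: "n \<in> semigroup_span A \<longleftrightarrow> n \<in> semigroup_span (A \<inter> {..n})"
proof
  assume "n \<in> semigroup_span A"
  then obtain xs where xs: "n = sum_list xs" "set xs \<subseteq> A"
    unfolding semigroup_span_def by blast
  then have "set xs \<subseteq> A \<inter> {..n}"
    using member_le_sum_list by fastforce
  then show "n \<in> semigroup_span (A \<inter> {..n})"
    using xs(1) span_sum_list_subset by blast
next
  assume "n \<in> semigroup_span (A \<inter> {..n})"
  then show "n \<in> semigroup_span A"
    using span_mono[of "A \<inter> {..n}" A] by auto
qed

lemma span_insert:
  assumes "n \<in> semigroup_span (insert a B)"
  obtains j n' where "n = j * a + n'" "n' \<in> semigroup_span B"
proof -
  obtain xs where xs: "n = sum_list xs" "set xs \<subseteq> insert a B"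
    using assms unfolding semigroup_span_def by blast
  have "\<exists>j n'. sum_list xs = j * a + n' \<and> n' \<in> semigroup_span B"
    using xs(2)
  proof (induction xs)
    case Nil
    show ?case by (rule exI[of _ 0], rule exI[of _ 0]) simp
  next
    case (Cons y ys)
    then obtain j n' where *: "sum_list ys = j * a + n'" "n' \<in> semigroup_span B"
      by auto
    show ?case
    proof (cases "y = a")
      case True
      then show ?thesis
        using * by (intro exI[of _ "Suc j"] exI[of _ n']) simp
    next
      case False
      then have "y \<in> B" using Cons.prems by auto
      then show ?thesis
        using * by (intro exI[of _ j] exI[of _ "y + n'"]) (simp add: span_add span_base)
    qed
  qed
  then show thesis using that xs(1) by blast
qed

section \<open>Minimal generators and the embedding dimension\<close>

text \<open>The minimal generators. The test looks only at elements of \<open>A\<close> below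
  \<open>a\<close>, so for a random set it is independent of the event \<open>a \<in> A\<close>.
  Zero is never an atom, because the empty sum lies in every span.\<close>

definition atoms :: "nat set \<Rightarrow> nat set" where
  "atoms A = {a \<in> A. a \<notin> semigroup_span (A \<inter> {..<a})}"

text \<open>Strong induction: a nonatom is a sum of smaller elements of \<open>A\<close>, and these
  are already generated by atoms.\<close>

lemma span_atoms: "semigroup_span (atoms A) = semigroup_span A"
proof
  show "semigroup_span (atoms A) \<subseteq> semigroup_span A"
    by (rule span_mono) (auto simp: atoms_def)
  have "a \<in> semigroup_span (atoms A)" if "a \<in> A" for a
    using that
  proof (induction a rule: less_induct)
    case (less a)
    show ?case
    proof (cases "a \<in> atoms A")
      case True
      then show ?thesis by (rule span_base)
    next
      case False
      then have "a \<in> semigroup_span (A \<inter> {..<a})"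
        using less.prems by (simp add: atoms_def)
      moreover have "semigroup_span (A \<inter> {..<a}) \<subseteq> semigroup_span (atoms A)"
        by (rule span_least) (use less.IH in auto)
      ultimately show ?thesis by blast
    qed
  qed
  then show "semigroup_span A \<subseteq> semigroup_span (atoms A)"
    by (intro span_least) auto
qed

text \<open>An atom \<open>g\<close> missing from \<open>B\<close> would be a sum of elements of
  \<open>B\<close> strictly below \<open>g\<close>. By locality each of these lies in the span of
  \<open>A \<inter> {..<g}\<close>, and then so does \<open>g\<close>.\<close>

lemma atoms_subset_generators:
  assumes "B \<subseteq> {0<..}" "semigroup_span B = semigroup_span A"
  shows "atoms A \<subseteq> B"
proof (rule subsetI, rule ccontr)
  fix g assume g: "g \<in> atoms A" "g \<notin> B"
  then have "g \<in> semigroup_span B"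
    using assms(2) by (auto simp: atoms_def span_base)
  then obtain xs where xs: "g = sum_list xs" "set xs \<subseteq> B"
    unfolding semigroup_span_def by blast
  have "x \<in> semigroup_span (A \<inter> {..<g})" if "x \<in> set xs" for x
  proof -
    have "x \<le> g" using that xs(1) member_le_sum_list by blast
    moreover have "x \<noteq> g" using that xs(2) g(2) by blast
    ultimately have "A \<inter> {..x} \<subseteq> A \<inter> {..<g}" by auto
    moreover have "x \<in> semigroup_span (A \<inter> {..x})"
      using that xs(2) assms(2) span_base span_atMost by blast
    ultimately show ?thesis using span_mono by blast
  qed
  then have "g \<in> semigroup_span (A \<inter> {..<g})"
    using xs(1) span_sum_list by blast
  then show False using g(1) by (simp add: atoms_def)
qed

text \<open>Two atoms \<open>a < b\<close> cannot be congruent modulo an element \<open>m\<close> of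
  \<open>A\<close>, since \<open>b\<close> would be \<open>a\<close> plus copies of
  \<open>m\<close>. So there are at most \<open>m\<close> atoms.\<close>

lemma finite_atoms:
  assumes "A \<subseteq> {0<..}"
  shows "finite (atoms A)"
proof (cases "A = {}")
  case True
  then show ?thesis by (simp add: atoms_def)
next
  case False
  then obtain m where m: "m \<in> A" by blast
  with assms have m0: "m > 0" by auto
  have "inj_on (\<lambda>a. a mod m) (atoms A)"
  proof (rule linorder_inj_onI)
    fix a b assume ab: "a < b" "a \<in> atoms A" "b \<in> atoms A"
    show "a mod m \<noteq> b mod m"
    proof
      assume "a mod m = b mod m"
      then have "m dvd b - a"
        by (metis ab(1) less_imp_le mod_eq_dvd_iff_nat)
      then obtain t where t: "b - a = t * m" by (metis dvd_div_mult_self)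
      then have b: "b = a + t * m" and "t > 0" using ab(1) by (auto intro: Nat.gr0I)
      \<comment> \<open>Positivity of \<open>a\<close> gives \<open>m < b\<close> even for
        \<open>t = 1\<close>, so that \<open>m\<close> is among the elements below
        \<open>b\<close>.\<close>
      have "a > 0" using ab(2) assms by (auto simp: atoms_def)
      have "m \<le> t * m" using \<open>t > 0\<close> by simp
      then have "m < b" using b \<open>a > 0\<close> by linarith
      then have "m \<in> A \<inter> {..<b}" "a \<in> A \<inter> {..<b}"
        using m ab by (auto simp: atoms_def)
      then have "b \<in> semigroup_span (A \<inter> {..<b})"
        unfolding b by (intro span_add span_mult span_base) (use b in auto)
      then show False using ab(3) by (simp add: atoms_def)
    qed
  qed auto
  moreover have "finite ((\<lambda>a. a mod m) ` atoms A)"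
    by (rule finite_subset[of _ "{..<m}"]) (use m0 in auto)
  ultimately show ?thesis using finite_imageD by blast
qed

text \<open>The set \<open>atoms A\<close> is generating, finite and contained in every generating
  set of positive integers, so it attains the minimum. This applies to every sample point.\<close>

lemma embedding_dim_span:
  assumes "A \<subseteq> {0<..}"
  shows "embedding_dim (semigroup_span A) = card (atoms A)"
  unfolding embedding_dim_def
proof (rule Least_equality)
  show "\<exists>B. finite B \<and> B \<subseteq> {0<..} \<and> semigroup_span B = semigroup_span A \<and> card B = card (atoms A)"
    using finite_atoms[OF assms] span_atoms[of A] assms
    by (intro exI[of _ "atoms A"]) (auto simp: atoms_def)
next
  fix k assume "\<exists>B. finite B \<and> B \<subseteq> {0<..} \<and> semigroup_span B = semigroup_span A \<and> card B = k"
  then show "card (atoms A) \<le> k"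
    using atoms_subset_generators card_mono by metis
qed

section \<open>Counting semigroup elements by generating functions\<close>

text \<open>The product of geometric series counts \<open>n\<close> once for each representation as
  a sum over \<open>B\<close>, hence every element of the span at least once. Cutting at
  \<open>N\<close> keeps the sums finite.\<close>

lemma sum_powers_span_le:
  fixes x :: real
  assumes "finite B" "B \<subseteq> {0<..}" "0 < x" "x < 1"
  shows "(\<Sum>n\<in>semigroup_span B \<inter> {..N}. x ^ n) \<le> (\<Prod>a\<in>B. 1 / (1 - x ^ a))"
  using assms(1,2)
proof (induction B rule: finite_induct)
  case empty
  then show ?case by (simp add: span_empty)
next
  case (insert a B)
  then have a: "a > 0" by auto
  have xa: "0 < x ^ a" "x ^ a < 1"
    using assms(3,4) a by (auto simp: power_less_one_iff)
  let ?S = "semigroup_span B \<inter> {..N}"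
  have sub: "semigroup_span (insert a B) \<inter> {..N} \<subseteq> (\<lambda>(j, n). j * a + n) ` ({..N} \<times> ?S)"
  proof
    fix n assume n: "n \<in> semigroup_span (insert a B) \<inter> {..N}"
    then obtain j n' where jn: "n = j * a + n'" "n' \<in> semigroup_span B"
      using span_insert by blast
    have "j \<le> j * a" using a by simp
    moreover have "n \<le> N" using n by simp
    ultimately have "j \<le> N" "n' \<le> N" using jn(1) by linarith+
    with jn show "n \<in> (\<lambda>(j, n). j * a + n) ` ({..N} \<times> ?S)"
      by (auto intro!: image_eqI[of _ _ "(j, n')"])
  qed
  have "(\<Sum>n\<in>semigroup_span (insert a B) \<inter> {..N}. x ^ n)
      \<le> (\<Sum>n\<in>(\<lambda>(j, n). j * a + n) ` ({..N} \<times> ?S). x ^ n)"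
    by (rule sum_mono2) (use sub assms(3) in auto)
  \<comment> \<open>Several pairs may represent the same number, which only enlarges the right
    side.\<close>
  also have "\<dots> \<le> (\<Sum>(j, n)\<in>{..N} \<times> ?S. x ^ (j * a + n))"
    by (rule order.trans[OF sum_image_le]) (use assms(3) in \<open>auto simp: o_def case_prod_unfold\<close>)
  also have "\<dots> = (\<Sum>j\<le>N. (x ^ a) ^ j) * (\<Sum>n\<in>?S. x ^ n)"
    by (simp add: sum_product sum.cartesian_product power_add power_mult mult.commute[of _ a])
  also have "\<dots> \<le> (1 / (1 - x ^ a)) * (\<Prod>a\<in>B. 1 / (1 - x ^ a))"
  proof (rule mult_mono)
    have "(\<Sum>j\<le>N. (x ^ a) ^ j) = (1 - (x ^ a) ^ Suc N) / (1 - x ^ a)"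
      using xa by (simp add: sum_gp0)
    also have "\<dots> \<le> 1 / (1 - x ^ a)"
      using xa by (intro divide_right_mono) (auto simp del: power_Suc)
    finally show "(\<Sum>j\<le>N. (x ^ a) ^ j) \<le> 1 / (1 - x ^ a)" .
  qed (use insert xa assms(3) in \<open>auto intro!: sum_nonneg\<close>)
  finally show ?case using insert by simp
qed

text \<open>Rankin's trick: \<open>x ^ n\<close> is at least \<open>x ^ N\<close> for
  \<open>n \<le> N\<close>, and by locality only the generators up to \<open>N\<close>
  matter.\<close>

lemma card_span_le:
  fixes x :: real
  assumes "A \<subseteq> {0<..}" "0 < x" "x < 1"
  shows "real (card (semigroup_span A \<inter> {..N})) * x ^ N \<le> (\<Prod>a\<in>A \<inter> {..N}. 1 / (1 - x ^ a))"
proof -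
  have "real (card (semigroup_span A \<inter> {..N})) * x ^ N = (\<Sum>n\<in>semigroup_span A \<inter> {..N}. x ^ N)"
    by simp
  also have "\<dots> \<le> (\<Sum>n\<in>semigroup_span A \<inter> {..N}. x ^ n)"
    by (rule sum_mono) (use assms in \<open>auto intro!: power_decreasing\<close>)
  also have eq: "semigroup_span A \<inter> {..N} = semigroup_span (A \<inter> {..N}) \<inter> {..N}"
  proof -
    have "n \<in> semigroup_span A \<longleftrightarrow> n \<in> semigroup_span (A \<inter> {..N})" if "n \<le> N" for n
    proof -
      have "A \<inter> {..N} \<inter> {..n} = A \<inter> {..n}" using that by auto
      then show ?thesis using span_atMost by metis
    qed
    then show ?thesis by auto
  qed
  also have "(\<Sum>n\<in>\<dots>. x ^ n) \<le> (\<Prod>a\<in>A \<inter> {..N}. 1 / (1 - x ^ a))"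
    by (rule sum_powers_span_le) (use assms in auto)
  finally show ?thesis by (simp only: eq)
qed

text \<open>The terms are dominated by telescoping differences of \<open>sqrt (1 - x ^ a)\<close>.
  The square root tames the singularity at small \<open>a\<close>: with
  \<open>1 / (1 - x ^ a)\<close> instead, the sum would carry an extra logarithm of
  \<open>1 / (1 - x)\<close>.\<close>

lemma sum_inverse_sqrt_le:
  fixes x :: real
  assumes "0 < x" "x < 1"
  shows "(\<Sum>a=1..N. 1 / sqrt (1 - x ^ a) - 1) \<le> 2 / (1 - x)"
proof -
  have "1 / sqrt (1 - x ^ Suc a) - 1 \<le> 2 / (1 - x) * (sqrt (1 - x ^ Suc a) - sqrt (1 - x ^ a))" for a
  proof -
    define u where "u = sqrt (1 - x ^ Suc a)"
    define v where "v = sqrt (1 - x ^ a)"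
    have xa: "0 < x ^ Suc a" "x ^ Suc a < 1" "x ^ Suc a \<le> x ^ a" "x ^ a \<le> 1"
      using assms by (auto simp: power_less_one_iff power_le_one mult_left_le_one_le
          simp del: power_Suc intro: power_decreasing)
    have u: "0 < u" "u \<le> 1" "u^2 = 1 - x ^ Suc a" and v: "0 \<le> v" "v \<le> u" "v^2 = 1 - x ^ a"
      unfolding u_def v_def using xa by auto
    \<comment> \<open>The chain is
      \<open>(1 - x) * (1 - u) \<le> u^2 - v^2 \<le> 2 * u * (u - v)\<close>, to be divided by
      \<open>(1 - x) * u\<close>.\<close>
    have "u^2 \<le> u"
      using u(1,2) by (simp add: power2_eq_square mult_left_le)
    then have "(1 - x) * (1 - u) \<le> (1 - x) * (1 - u^2)"
      using assms by (intro mult_left_mono) auto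
    also have "1 - u^2 = x * x ^ a" using u by simp
    also have "(1 - x) * (x * x ^ a) \<le> (1 - x) * x ^ a"
      using assms xa by (intro mult_left_mono) auto
    also have "(1 - x) * x ^ a = u^2 - v^2" using u v by (simp add: algebra_simps)
    also have "\<dots> = (u + v) * (u - v)" by (simp add: power2_eq_square algebra_simps)
    also have "\<dots> \<le> (2 * u) * (u - v)" using v by (intro mult_right_mono) auto
    finally have "1 - u \<le> 2 * u * (u - v) / (1 - x)"
      using assms by (simp add: pos_le_divide_eq mult.commute)
    then have "(1 - u) / u \<le> (2 * u * (u - v) / (1 - x)) / u"
      using u by (intro divide_right_mono) auto
    moreover have "(1 - u) / u = 1 / u - 1" "(2 * u * (u - v) / (1 - x)) / u = 2 / (1 - x) * (u - v)"
      using u by (simp_all add: diff_divide_distrib)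
    ultimately show ?thesis
      unfolding u_def v_def by simp
  qed
  then have "(\<Sum>a<N. 1 / sqrt (1 - x ^ Suc a) - 1)
      \<le> (\<Sum>a<N. 2 / (1 - x) * (sqrt (1 - x ^ Suc a) - sqrt (1 - x ^ a)))"
    by (rule sum_mono)
  also have "\<dots> = 2 / (1 - x) * (\<Sum>a<N. sqrt (1 - x ^ Suc a) - sqrt (1 - x ^ a))"
    by (simp only: sum_distrib_left)
  also have "(\<Sum>a<N. sqrt (1 - x ^ Suc a) - sqrt (1 - x ^ a)) = sqrt (1 - x ^ N)"
    by (subst sum_lessThan_telescope) simp
  also have "2 / (1 - x) * sqrt (1 - x ^ N) \<le> 2 / (1 - x)"
    using assms by (intro mult_left_le) auto
  finally show ?thesis
    by (simp add: sum.atLeast1_atMost_eq)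
qed

section \<open>Bernoulli random sets\<close>

locale bernoulli_set =
  fixes p :: real
  assumes p_pos: "0 < p" and p_less_1: "p < 1"
begin

abbreviation M where "M \<equiv> bernoulli_space p"

sublocale prob_space M
  by (rule prob_space_bernoulli_space)

sublocale product: product_prob_space "\<lambda>_. measure_pmf (bernoulli_pmf p)" "{0<..}"
  by unfold_locales

section \<open>Events and functions of finitely many coordinates\<close>

lemma measurable_coordinate [measurable]:
  assumes "0 < i"
  shows "(\<lambda>\<omega>. \<omega> i) \<in> measurable M (count_space UNIV)"
proof -
  have "(\<lambda>\<omega>. \<omega> i) \<in> measurable M (measure_pmf (bernoulli_pmf p))"
    unfolding bernoulli_space_def using assms by (intro measurable_component_singleton) auto
  then show ?thesis by simp
qed

lemma measurable_mem_random_set [measurable]: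
  "(\<lambda>\<omega>. i \<in> random_set \<omega>) \<in> measurable M (count_space UNIV)"
  by (cases "0 < i") (simp_all add: random_set_def)

lemma measurable_random_set_inter:
  assumes "finite J"
  shows "(\<lambda>\<omega>. random_set \<omega> \<inter> J) \<in> measurable M (count_space UNIV)"
  using assms
proof (induction J rule: finite_induct)
  case empty
  then show ?case by simp
next
  case (insert i J)
  have "(\<lambda>\<omega>. random_set \<omega> \<inter> insert i J) =
      (\<lambda>\<omega>. (if i \<in> random_set \<omega> then insert i else id) (random_set \<omega> \<inter> J))"
    by (rule ext) auto
  also have "\<dots> = (\<lambda>\<omega>. (\<lambda>(b, X). (if b then insert i else id) X) (i \<in> random_set \<omega>, random_set \<omega> \<inter> J))"
    by (rule ext) auto
  also have "\<dots> \<in> measurable M (count_space UNIV)"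
  proof (rule measurable_compose_countable'[where I = UNIV and g = "\<lambda>\<omega>. i \<in> random_set \<omega>"
        and f = "\<lambda>b \<omega>. (\<lambda>(b, X). (if b then insert i else id) X) (b, random_set \<omega> \<inter> J)"])
    show "(\<lambda>\<omega>. case (b, random_set \<omega> \<inter> J) of (b, X) \<Rightarrow> (if b then insert i else id) X)
        \<in> measurable M (count_space UNIV)" for b
      using measurable_compose[OF insert.IH, of "if b then insert i else id" "count_space UNIV"] by simp
  qed auto
  finally show ?case .
qed

lemma measurable_local:
  assumes "finite J" "\<And>x. f x \<in> space N"
  shows "(\<lambda>\<omega>. f (random_set \<omega> \<inter> J)) \<in> measurable M N"
  by (rule measurable_compose[OF measurable_random_set_inter[OF assms(1)]]) (use assms(2) in simp)

lemma sets_local: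
  assumes "finite J"
  shows "{\<omega> \<in> space M. Q (random_set \<omega> \<inter> J)} \<in> events"
proof -
  have [measurable]: "(\<lambda>\<omega>. Q (random_set \<omega> \<inter> J)) \<in> measurable M (count_space UNIV)"
    using assms by (rule measurable_local) simp
  show ?thesis by measurable
qed

lemma integrable_local:
  fixes f :: "nat set \<Rightarrow> real"
  assumes "finite J"
  shows "integrable M (\<lambda>\<omega>. f (random_set \<omega> \<inter> J))"
proof (rule integrable_const_bound[where B = "Max ((\<lambda>X. \<bar>f X\<bar>) ` Pow J)"])
  show "AE \<omega> in M. norm (f (random_set \<omega> \<inter> J)) \<le> Max ((\<lambda>X. \<bar>f X\<bar>) ` Pow J)"
    using assms by (intro AE_I2) (auto intro!: Max_ge)
qed (use assms in \<open>simp add: measurable_local\<close>)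

text \<open>Restriction to \<open>J\<close> yields a finite product measure, over which the integral
  of a product factors. Every later use of independence goes through this identity.\<close>

lemma expectation_prod:
  fixes h :: "nat \<Rightarrow> bool \<Rightarrow> real"
  assumes J: "finite J" "J \<subseteq> {0<..}"
  shows "expectation (\<lambda>\<omega>. \<Prod>i\<in>J. h i (i \<in> random_set \<omega>)) = (\<Prod>i\<in>J. p * h i True + (1 - p) * h i False)"
proof -
  let ?B = "\<lambda>_::nat. measure_pmf (bernoulli_pmf p)"
  have "expectation (\<lambda>\<omega>. \<Prod>i\<in>J. h i (i \<in> random_set \<omega>))
      = expectation (\<lambda>\<omega>. \<Prod>i\<in>J. h i (restrict \<omega> J i))"
    using J by (intro Bochner_Integration.integral_cong prod.cong) (auto simp: random_set_def)
  also have "\<dots> = integral\<^sup>L (distr M (PiM J ?B) (\<lambda>\<omega>. restrict \<omega> J)) (\<lambda>\<omega>. \<Prod>i\<in>J. h i (\<omega> i))"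
    unfolding bernoulli_space_def
    using J
    by (subst integral_distr)
      (auto intro!: measurable_restrict_subset borel_measurable_prod
        measurable_compose[OF measurable_component_singleton])
  also have "distr M (PiM J ?B) (\<lambda>\<omega>. restrict \<omega> J) = PiM J ?B"
    unfolding bernoulli_space_def using J by (intro product.distr_PiM_restrict_finite) auto
  also have "integral\<^sup>L (PiM J ?B) (\<lambda>\<omega>. \<Prod>i\<in>J. h i (\<omega> i)) = (\<Prod>i\<in>J. integral\<^sup>L (?B i) (h i))"
    using J by (intro product.product_integral_prod) (auto intro!: integrable_measure_pmf_finite)
  also have "\<dots> = (\<Prod>i\<in>J. p * h i True + (1 - p) * h i False)"
    using p_pos p_less_1 by (simp add: mult.commute)
  finally show ?thesis .
qed

lemma prob_local_prod:
  assumes "finite J" "J \<subseteq> {0<..}"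
    and "\<And>\<omega>. \<omega> \<in> space M \<Longrightarrow> Q (random_set \<omega>) \<longleftrightarrow> (\<forall>i\<in>J. h i (i \<in> random_set \<omega>))"
  shows "prob {\<omega> \<in> space M. Q (random_set \<omega>)} = (\<Prod>i\<in>J. p * of_bool (h i True) + (1 - p) * of_bool (h i False))"
proof -
  have "prob {\<omega> \<in> space M. Q (random_set \<omega>)} = expectation (indicator {\<omega> \<in> space M. Q (random_set \<omega>)})"
  proof -
    have "{\<omega> \<in> space M. Q (random_set \<omega>)} = {\<omega> \<in> space M. \<forall>i\<in>J. h i (i \<in> random_set \<omega> \<inter> J)}"
      using assms(3) by auto
    also have "\<dots> \<in> events" using assms(1) by (rule sets_local)
    finally show ?thesis by simp
  qed
  also have "\<dots> = expectation (\<lambda>\<omega>. \<Prod>i\<in>J. of_bool (h i (i \<in> random_set \<omega>)))"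
    using assms by (intro Bochner_Integration.integral_cong refl) (auto simp: indicator_def)
  also have "\<dots> = (\<Prod>i\<in>J. p * of_bool (h i True) + (1 - p) * of_bool (h i False))"
    using assms(1,2) by (rule expectation_prod)
  finally show ?thesis .
qed

text \<open>Equality fails if \<open>0 \<in> T\<close>: the random set has only positive elements,
  so the event is then empty.\<close>

lemma prob_subset_random_set_le:
  assumes "finite T"
  shows "prob {\<omega> \<in> space M. T \<subseteq> random_set \<omega>} \<le> p ^ card T"
proof (cases "0 \<in> T")
  case True
  then have eq: "{\<omega> \<in> space M. T \<subseteq> random_set \<omega>} = {}"
    by (auto simp: random_set_def)
  show ?thesis unfolding eq using p_pos by simp
next
  case False
  then have T: "T \<subseteq> {0<..}" by (metis gr0I greaterThan_iff subsetI)
  have "prob {\<omega> \<in> space M. T \<subseteq> random_set \<omega>} = (\<Prod>i\<in>T. p * of_bool True + (1 - p) * of_bool False)"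
    by (rule prob_local_prod[OF assms T, where h = "\<lambda>_ b. b"]) auto
  then show ?thesis by simp
qed

lemma expectation_card:
  assumes "finite J" "J \<subseteq> {0<..}"
  shows "expectation (\<lambda>\<omega>. real (card (random_set \<omega> \<inter> J))) = p * card J"
proof -
  have "real (card (random_set \<omega> \<inter> J)) = (\<Sum>i\<in>J. \<Prod>i\<in>{i}. of_bool (i \<in> random_set \<omega>))" for \<omega>
    using assms(1) by (simp add: Int_commute)
  then have "expectation (\<lambda>\<omega>. real (card (random_set \<omega> \<inter> J)))
      = (\<Sum>i\<in>J. expectation (\<lambda>\<omega>. \<Prod>i\<in>{i}. of_bool (i \<in> random_set \<omega>)))"
    by (simp only:) (rule Bochner_Integration.integral_sum, simp,
      rule integrable_const_bound[where B = 1], auto)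
  also have "\<dots> = (\<Sum>i\<in>J. p)"
    by (intro sum.cong refl, subst expectation_prod) (use assms in auto)
  finally show ?thesis by simp
qed

lemma expectation_power_card:
  fixes t :: real
  assumes "finite J" "J \<subseteq> {0<..}"
  shows "expectation (\<lambda>\<omega>. t ^ card (random_set \<omega> \<inter> J)) = (1 - p + p * t) ^ card J"
proof -
  have "t ^ card (random_set \<omega> \<inter> J) = (\<Prod>i\<in>J. if i \<in> random_set \<omega> then t else 1)" for \<omega>
    using assms(1) by (simp add: prod.If_cases Int_commute)
  then show ?thesis
    using expectation_prod[OF assms, of "\<lambda>_ b. if b then t else 1"] by (simp add: algebra_simps)
qed

section \<open>Chernoff bounds and independence of a new element\<close>

text \<open>Markov's inequality for \<open>(1 / 2) ^ card\<close>, whose expectation is at most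
  \<open>exp (- \<mu> / 2)\<close>. The level costs
  \<open>2 powr (3 / 5 * \<mu>) \<le> exp (5 / 12 * \<mu>)\<close>, because
  \<open>ln 2 \<le> 25 / 36\<close>, and \<open>1 / 2 - 5 / 12 = 1 / 12\<close>.\<close>

lemma prob_card_lower_tail:
  assumes J: "finite J" "J \<subseteq> {0<..}"
  shows "prob {\<omega> \<in> space M. real (card (random_set \<omega> \<inter> J)) < 3 / 5 * (p * card J)} \<le> exp (- (p * card J) / 12)"
proof -
  define \<mu> where "\<mu> = p * card J"
  have \<mu>: "\<mu> \<ge> 0" unfolding \<mu>_def using p_pos by simp
  let ?t = "2 powr (- (3 / 5 * \<mu>))"
  have "prob {\<omega> \<in> space M. real (card (random_set \<omega> \<inter> J)) < 3 / 5 * \<mu>}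
      \<le> prob {\<omega> \<in> space M. (1 / 2) ^ card (random_set \<omega> \<inter> J) \<ge> ?t}"
  proof (rule finite_measure_mono)
    show "{\<omega> \<in> space M. real (card (random_set \<omega> \<inter> J)) < 3 / 5 * \<mu>}
      \<subseteq> {\<omega> \<in> space M. (1 / 2) ^ card (random_set \<omega> \<inter> J) \<ge> ?t}"
    proof safe
      fix \<omega> assume "real (card (random_set \<omega> \<inter> J)) < 3 / 5 * \<mu>"
      then have "?t \<le> 2 powr (- real (card (random_set \<omega> \<inter> J)))" by simp
      also have "\<dots> = (1 / 2) ^ card (random_set \<omega> \<inter> J)"
        by (simp add: powr_minus powr_realpow power_one_over inverse_eq_divide)
      finally show "?t \<le> (1 / 2) ^ card (random_set \<omega> \<inter> J)" .
    qed
    show "{\<omega> \<in> space M. (1 / 2) ^ card (random_set \<omega> \<inter> J) \<ge> ?t} \<in> events"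
      by (rule sets_local) (rule J)
  qed
  also have "\<dots> \<le> expectation (\<lambda>\<omega>. (1 / 2) ^ card (random_set \<omega> \<inter> J)) / ?t"
    by (rule integral_Markov_inequality_measure[where A = "{}"])
      (use J in \<open>auto intro: integrable_local\<close>)
  also have "\<dots> = (1 - p / 2) ^ card J * 2 powr (3 / 5 * \<mu>)"
  proof -
    have "1 - p + p * (1 / 2) = 1 - p / 2" by simp
    then show ?thesis
      by (simp only: expectation_power_card[OF J] powr_minus divide_inverse inverse_inverse_eq)
  qed
  also have "\<dots> \<le> exp (- \<mu> / 2) * exp (5 / 12 * \<mu>)"
  proof (rule mult_mono)
    have "(1 - p / 2) ^ card J \<le> exp (- p / 2) ^ card J"
      using p_less_1 exp_ge_add_one_self[of "- p / 2"] by (intro power_mono) auto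
    also have "\<dots> = exp (of_nat (card J) * (- p / 2))"
      by (rule exp_of_nat_mult[symmetric])
    also have "\<dots> = exp (- \<mu> / 2)"
      by (simp add: \<mu>_def mult.commute)
    finally show "(1 - p / 2) ^ card J \<le> exp (- \<mu> / 2)" .
    have "3 / 5 * \<mu> * ln 2 \<le> 3 / 5 * \<mu> * (25 / 36)"
      using \<mu> ln2_le_25_over_36 by (intro mult_left_mono) auto
    then show "2 powr (3 / 5 * \<mu>) \<le> exp (5 / 12 * \<mu>)"
      by (simp add: powr_def)
  qed auto
  also have "\<dots> = exp (- \<mu> / 12)"
    by (simp add: exp_add[symmetric])
  finally show ?thesis by (simp add: \<mu>_def)
qed

text \<open>Markov's inequality for \<open>2 ^ card\<close>, whose expectation is at most
  \<open>exp \<mu>\<close>. The level gains \<open>exp (- 4 / 3 * \<mu>)\<close>, because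
  \<open>ln 2 \<ge> 2 / 3\<close>.\<close>

lemma prob_card_upper_tail:
  assumes J: "finite J" "J \<subseteq> {0<..}"
  shows "prob {\<omega> \<in> space M. real (card (random_set \<omega> \<inter> J)) > 2 * (p * card J)} \<le> exp (- (p * card J) / 3)"
proof -
  define \<mu> where "\<mu> = p * card J"
  have \<mu>: "\<mu> \<ge> 0" unfolding \<mu>_def using p_pos by simp
  let ?t = "2 powr (2 * \<mu>)"
  have "prob {\<omega> \<in> space M. real (card (random_set \<omega> \<inter> J)) > 2 * \<mu>}
      \<le> prob {\<omega> \<in> space M. 2 ^ card (random_set \<omega> \<inter> J) \<ge> ?t}"
  proof (rule finite_measure_mono)
    show "{\<omega> \<in> space M. real (card (random_set \<omega> \<inter> J)) > 2 * \<mu>}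
      \<subseteq> {\<omega> \<in> space M. 2 ^ card (random_set \<omega> \<inter> J) \<ge> ?t}"
    proof safe
      fix \<omega> assume "real (card (random_set \<omega> \<inter> J)) > 2 * \<mu>"
      then have "?t \<le> 2 powr (real (card (random_set \<omega> \<inter> J)))" by simp
      then show "?t \<le> 2 ^ card (random_set \<omega> \<inter> J)" by (simp add: powr_realpow)
    qed
    show "{\<omega> \<in> space M. 2 ^ card (random_set \<omega> \<inter> J) \<ge> ?t} \<in> events"
      by (rule sets_local) (rule J)
  qed
  also have "\<dots> \<le> expectation (\<lambda>\<omega>. 2 ^ card (random_set \<omega> \<inter> J)) / ?t"
    by (rule integral_Markov_inequality_measure[where A = "{}"])
      (use J in \<open>auto intro: integrable_local\<close>)
  also have "\<dots> = (1 + p) ^ card J * 2 powr (- 2 * \<mu>)"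
    by (subst expectation_power_card[OF J]) (simp add: powr_minus divide_inverse add.commute)
  also have "\<dots> \<le> exp \<mu> * exp (- 4 / 3 * \<mu>)"
  proof (rule mult_mono)
    have "(1 + p) ^ card J \<le> exp p ^ card J"
      using p_pos exp_ge_add_one_self[of p] by (intro power_mono) auto
    also have "\<dots> = exp (of_nat (card J) * p)"
      by (rule exp_of_nat_mult[symmetric])
    also have "\<dots> = exp \<mu>"
      by (simp add: \<mu>_def mult.commute)
    finally show "(1 + p) ^ card J \<le> exp \<mu>" .
    have "2 * \<mu> * ln 2 \<ge> 2 * \<mu> * (2 / 3)"
      using \<mu> ln2_ge_two_thirds by (intro mult_left_mono) auto
    then show "2 powr (- 2 * \<mu>) \<le> exp (- 4 / 3 * \<mu>)"
      by (simp add: powr_def)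
  qed auto
  also have "\<dots> = exp (- \<mu> / 3)"
    by (simp add: exp_add[symmetric])
  finally show ?thesis by (simp add: \<mu>_def)
qed

text \<open>The coordinate of \<open>a\<close> is independent of those below it. The event splits
  according to the trace \<open>B\<close> of the random set below \<open>a\<close>, and prescribing
  \<open>a\<close> as well multiplies each piece by \<open>p\<close>.\<close>

lemma prob_insert_local:
  assumes "0 < a"
  shows "prob {\<omega> \<in> space M. a \<in> random_set \<omega> \<and> Q (random_set \<omega> \<inter> {..<a})}
    = p * prob {\<omega> \<in> space M. Q (random_set \<omega> \<inter> {..<a})}"
proof -
  define I where "I = {1..<a}"
  define \<B> where "\<B> = {B. B \<subseteq> I \<and> Q B}"
  have fin: "finite I" "finite \<B>" "I \<subseteq> {0<..}" "a \<notin> I" by (auto simp: I_def \<B>_def)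
  \<comment> \<open>Index 0 never belongs to the random set and has no coordinate, so it is dropped
    from the index range.\<close>
  have eq: "random_set \<omega> \<inter> {..<a} = random_set \<omega> \<inter> I" for \<omega>
    by (auto simp: random_set_def I_def)
  define E where "E B = {\<omega> \<in> space M. random_set \<omega> \<inter> I = B}" for B
  define E' where "E' B = {\<omega> \<in> space M. random_set \<omega> \<inter> insert a I = insert a B}" for B
  have sets: "E B \<in> events" "E' B \<in> events" for B
    unfolding E_def E'_def using fin by (intro sets_local; simp)+
  have E: "prob (E' B) = p * prob (E B)" if "B \<in> \<B>" for B
  proof -
    have B: "B \<subseteq> I" using that by (simp add: \<B>_def)
    have "prob (E B) = (\<Prod>i\<in>I. p * of_bool (True \<longleftrightarrow> i \<in> B) + (1 - p) * of_bool (False \<longleftrightarrow> i \<in> B))"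
      unfolding E_def
      by (rule prob_local_prod[where h = "\<lambda>i b. b \<longleftrightarrow> i \<in> B"]) (use fin B in auto)
    moreover have "prob (E' B) = (\<Prod>i\<in>insert a I. p * of_bool (True \<longleftrightarrow> i \<in> insert a B)
        + (1 - p) * of_bool (False \<longleftrightarrow> i \<in> insert a B))"
      unfolding E'_def
      by (rule prob_local_prod[where h = "\<lambda>i b. b \<longleftrightarrow> i \<in> insert a B"]) (use fin B assms in auto)
    moreover have "(\<Prod>i\<in>I. p * of_bool (True \<longleftrightarrow> i \<in> insert a B) + (1 - p) * of_bool (False \<longleftrightarrow> i \<in> insert a B))
      = (\<Prod>i\<in>I. p * of_bool (True \<longleftrightarrow> i \<in> B) + (1 - p) * of_bool (False \<longleftrightarrow> i \<in> B))"
      using fin by (intro prod.cong) auto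
    ultimately show ?thesis
      using fin by (simp only: prod.insert) simp
  qed
  have insert_iff: "random_set \<omega> \<inter> insert a I = insert a B \<longleftrightarrow> a \<in> random_set \<omega> \<and> random_set \<omega> \<inter> I = B"
    if "B \<in> \<B>" for \<omega> B
  proof -
    have "a \<notin> B" using that fin(4) by (auto simp: \<B>_def)
    then show ?thesis using fin(4)
      by (cases "a \<in> random_set \<omega>") (auto simp: Int_insert_right insert_ident)
  qed
  then have E'_alt: "E' B = {\<omega> \<in> space M. a \<in> random_set \<omega> \<and> random_set \<omega> \<inter> I = B}" if "B \<in> \<B>" for B
    unfolding E'_def using that by auto
  then have "disjoint_family_on E' \<B>"
    by (auto simp: disjoint_family_on_def)
  moreover have "{\<omega> \<in> space M. a \<in> random_set \<omega> \<and> Q (random_set \<omega> \<inter> {..<a})} = (\<Union>B\<in>\<B>. E' B)"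
    unfolding eq using E'_alt by (auto simp: \<B>_def)
  ultimately have "prob {\<omega> \<in> space M. a \<in> random_set \<omega> \<and> Q (random_set \<omega> \<inter> {..<a})} = (\<Sum>B\<in>\<B>. prob (E' B))"
    using sets fin by (simp add: finite_measure_finite_Union image_subset_iff)
  also have "\<dots> = p * (\<Sum>B\<in>\<B>. prob (E B))"
    using E by (simp add: sum_distrib_left)
  also have "(\<Sum>B\<in>\<B>. prob (E B)) = prob (\<Union>B\<in>\<B>. E B)"
    by (rule finite_measure_finite_Union[symmetric])
      (use sets fin in \<open>auto simp: disjoint_family_on_def E_def\<close>)
  also have "(\<Union>B\<in>\<B>. E B) = {\<omega> \<in> space M. Q (random_set \<omega> \<inter> {..<a})}"
    unfolding eq E_def \<B>_def by auto
  finally show ?thesis .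
qed

end

section \<open>The number of elements of a random semigroup\<close>

text \<open>Only the gaps up to \<open>N\<close> are counted. Finiteness matters because
  \<open>card\<close> is 0 on an infinite set of gaps.\<close>

lemma genus_ge:
  assumes "finite ({0<..} - S)"
  shows "real N - real (card (S \<inter> {..N})) \<le> real (genus S)"
proof -
  have "card {1..N} - card (S \<inter> {..N}) \<le> card ({1..N} - S \<inter> {..N})"
    by (rule diff_card_le_card_Diff) simp
  also have "\<dots> \<le> genus S"
    unfolding genus_def by (rule card_mono) (use assms in auto)
  finally show ?thesis by simp
qed

text \<open>All gaps lie between 1 and the Frobenius number. The 1 is lost only to the convention
  for \<open>UNIV\<close>, which has genus 0 and Frobenius number -1.\<close>

lemma frobenius_ge_genus:
  assumes "finite ({0<..} - S)" "0 \<in> S"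
  shows "int (genus S) - 1 \<le> frobenius S"
proof (cases "S = UNIV")
  case True
  then show ?thesis by (simp add: genus_def frobenius_def)
next
  case False
  have "x \<in> S" if "{0<..} - S = {}" for x
    using assms(2) that by (cases "x = 0") auto
  then have "{0<..} - S \<noteq> {}" using False by auto
  then have "{0<..} - S \<subseteq> {1..Max ({0<..} - S)}"
    using assms(1) by (auto intro: Max_ge)
  from card_mono[OF finite_atLeastAtMost this] have "genus S \<le> Max ({0<..} - S)"
    by (simp add: genus_def)
  then show ?thesis using False assms \<open>{0<..} - S \<noteq> {}\<close>
    by (simp add: frobenius_def Sup_nat_def)
qed

lemma frobenius_ge: "- 1 \<le> frobenius S"
  by (simp add: frobenius_def)

lemma random_set_subset: "random_set \<omega> \<subseteq> {0<..}"
  by (auto simp: random_set_def)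

lemma mem_random_semigroup_iff:
  assumes "n \<le> N"
  shows "n \<in> random_semigroup \<omega> \<longleftrightarrow> n \<in> semigroup_span (random_set \<omega> \<inter> {..N})"
proof -
  have "random_set \<omega> \<inter> {..N} \<inter> {..n} = random_set \<omega> \<inter> {..n}" using assms by auto
  then show ?thesis
    unfolding random_semigroup_def
    using span_atMost[of n "random_set \<omega>"] span_atMost[of n "random_set \<omega> \<inter> {..N}"] by simp
qed

lemma random_semigroup_atMost:
  "random_semigroup \<omega> \<inter> {..N} = semigroup_span (random_set \<omega> \<inter> {..N}) \<inter> {..N}"
  using mem_random_semigroup_iff by auto

lemma embedding_dim_random_semigroup:
  "embedding_dim (random_semigroup \<omega>) = card (atoms (random_set \<omega>))"
  unfolding random_semigroup_def by (rule embedding_dim_span[OF random_set_subset])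

text \<open>The elements of \<open>A\<close> up to \<open>N\<close> that are not minimal
  generators.\<close>

definition redundant :: "nat \<Rightarrow> nat set \<Rightarrow> nat set" where
  "redundant N A = {a \<in> A \<inter> {..N}. a \<in> semigroup_span (A \<inter> {..<a})}"

lemma card_atoms_ge:
  assumes "A \<subseteq> {0<..}"
  shows "real (card (A \<inter> {1..N})) - real (card (redundant N A)) \<le> real (card (atoms A))"
proof -
  have "card (A \<inter> {1..N}) - card (redundant N A) \<le> card (A \<inter> {1..N} - redundant N A)"
    by (rule diff_card_le_card_Diff) (simp add: redundant_def)
  also have "\<dots> \<le> card (atoms A)"
    by (rule card_mono) (use finite_atoms[OF assms] in \<open>auto simp: redundant_def atoms_def\<close>)
  finally show ?thesis by simp
qed

context bernoulli_set
begin

text \<open>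
  Every submonoid of the natural numbers is finitely generated, so \<^const>\<open>random_semigroup\<close> takes only
  countably many values.
\<close>

lemma measurable_random_semigroup:
  assumes "\<And>S. f S \<in> space N"
  shows "(\<lambda>\<omega>. f (random_semigroup \<omega>)) \<in> measurable M N"
proof -
  let ?\<S> = "semigroup_span ` {B. finite B}"
  have [measurable]: "Measurable.pred M (\<lambda>\<omega>. n \<in> random_semigroup \<omega>)" for n
    unfolding mem_random_semigroup_iff[OF order_refl] by (rule measurable_local) auto
  have "random_semigroup \<in> measurable M (count_space ?\<S>)"
  proof (subst measurable_count_space_eq_countable)
    show "countable ?\<S>" by (intro countable_image countable_Collect_finite)
    have "random_semigroup \<omega> \<in> ?\<S>" for \<omega>
      unfolding random_semigroup_def
      using span_atoms[of "random_set \<omega>"] finite_atoms[OF random_set_subset[of \<omega>]] by (metis imageI mem_Collect_eq)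
    moreover have "random_semigroup -` {S} \<inter> space M \<in> events" for S
    proof -
      have "random_semigroup -` {S} \<inter> space M = {\<omega> \<in> space M. \<forall>n. n \<in> random_semigroup \<omega> \<longleftrightarrow> n \<in> S}"
        by (rule set_eqI) (simp add: set_eq_iff conj_commute)
      moreover have "\<dots> \<in> events" by measurable
      ultimately show ?thesis by simp
    qed
    ultimately show "random_semigroup \<in> space M \<rightarrow> ?\<S> \<and> (\<forall>S\<in>?\<S>. random_semigroup -` {S} \<inter> space M \<in> events)"
      by blast
  qed
  then show ?thesis
    by (rule measurable_compose) (use assms in simp)
qed

section \<open>The expected number of semigroup elements and of redundant generators\<close>

text \<open>The square root of the bound in \<open>card_span_le\<close> is a product over
  independent coordinates. Each factor has expectation
  \<open>1 + p * (1 / sqrt (1 - x ^ a) - 1)\<close>, and \<open>sum_inverse_sqrt_le\<close> bounds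
  the sum in the exponent.\<close>

lemma expectation_sqrt_card_le:
  assumes x: "0 < x" "x < 1"
  shows "expectation (\<lambda>\<omega>. sqrt (card (random_semigroup \<omega> \<inter> {..N}))) * sqrt (x ^ N) \<le> exp (2 * p / (1 - x))"
proof -
  define h where "h a b = (if b then 1 / sqrt (1 - x ^ a) else 1)" for a :: nat and b
  have *: "sqrt (card (random_semigroup \<omega> \<inter> {..N})) * sqrt (x ^ N) \<le> (\<Prod>a\<in>{1..N}. h a (a \<in> random_set \<omega>))" for \<omega>
  proof -
    have "sqrt (card (random_semigroup \<omega> \<inter> {..N})) * sqrt (x ^ N)
        \<le> sqrt (\<Prod>a\<in>random_set \<omega> \<inter> {..N}. 1 / (1 - x ^ a))"
      unfolding real_sqrt_mult[symmetric] random_semigroup_def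
      by (rule real_sqrt_le_mono[OF card_span_le[OF random_set_subset x]])
    also have "\<dots> = (\<Prod>a\<in>random_set \<omega> \<inter> {..N}. 1 / sqrt (1 - x ^ a))"
      by (induction rule: infinite_finite_induct) (auto simp: real_sqrt_mult real_sqrt_divide)
    also have "random_set \<omega> \<inter> {..N} = {1..N} \<inter> {a. a \<in> random_set \<omega>}"
      by (auto simp: random_set_def)
    also have "(\<Prod>a\<in>\<dots>. 1 / sqrt (1 - x ^ a)) = (\<Prod>a\<in>{1..N}. h a (a \<in> random_set \<omega>))"
      by (simp add: h_def prod.If_cases)
    finally show ?thesis .
  qed
  have eq: "(\<Prod>a\<in>{1..N}. h a (a \<in> X)) = (\<Prod>a\<in>{1..N}. h a (a \<in> X \<inter> {1..N}))" for X
    by (rule prod.cong) auto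
  have "expectation (\<lambda>\<omega>. sqrt (card (random_semigroup \<omega> \<inter> {..N}))) * sqrt (x ^ N)
      = expectation (\<lambda>\<omega>. sqrt (card (random_semigroup \<omega> \<inter> {..N})) * sqrt (x ^ N))"
    by simp
  also have "\<dots> \<le> expectation (\<lambda>\<omega>. \<Prod>a\<in>{1..N}. h a (a \<in> random_set \<omega>))"
  proof (rule integral_mono)
    show "integrable M (\<lambda>\<omega>. sqrt (card (random_semigroup \<omega> \<inter> {..N})) * sqrt (x ^ N))"
      unfolding random_semigroup_atMost by (rule integrable_local) simp
    show "integrable M (\<lambda>\<omega>. \<Prod>a\<in>{1..N}. h a (a \<in> random_set \<omega>))"
      by (subst eq) (rule integrable_local, simp)
  qed (rule *)
  also have "\<dots> = (\<Prod>a\<in>{1..N}. p * h a True + (1 - p) * h a False)"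
    by (rule expectation_prod) auto
  also have "\<dots> \<le> (\<Prod>a\<in>{1..N}. exp (p * (1 / sqrt (1 - x ^ a) - 1)))"
  proof (rule prod_mono)
    fix a assume "a \<in> {1..N}"
    then have "x ^ a \<le> 1" using x by (simp add: power_le_one)
    then have "0 \<le> p * h a True + (1 - p) * h a False" using p_pos p_less_1 by (simp add: h_def)
    moreover have "p * h a True + (1 - p) * h a False = 1 + p * (1 / sqrt (1 - x ^ a) - 1)"
      by (simp add: h_def algebra_simps)
    moreover have "\<dots> \<le> exp (p * (1 / sqrt (1 - x ^ a) - 1))" by (rule exp_ge_add_one_self)
    ultimately show "0 \<le> p * h a True + (1 - p) * h a False \<and>
        p * h a True + (1 - p) * h a False \<le> exp (p * (1 / sqrt (1 - x ^ a) - 1))" by simp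
  qed
  also have "\<dots> = exp (p * (\<Sum>a=1..N. 1 / sqrt (1 - x ^ a) - 1))"
    by (simp only: exp_sum[OF finite_atLeastAtMost] sum_distrib_left)
  also have "\<dots> \<le> exp (p * (2 / (1 - x)))"
    unfolding exp_le_cancel_iff by (intro mult_left_mono sum_inverse_sqrt_le x) (use p_pos in simp)
  finally show ?thesis by (simp add: mult.commute)
qed

text \<open>At most \<open>N + 1\<close> elements lie in \<open>{..N}\<close>, so the cardinality is
  at most \<open>sqrt (N + 1)\<close> times its own square root.\<close>

lemma expectation_card_semigroup_le_sqrt:
  assumes x: "0 < x" "x < 1"
  shows "expectation (\<lambda>\<omega>. real (card (random_semigroup \<omega> \<inter> {..N})))
    \<le> sqrt (real N + 1) * exp (2 * p / (1 - x)) / sqrt (x ^ N)"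
proof -
  have "expectation (\<lambda>\<omega>. real (card (random_semigroup \<omega> \<inter> {..N})))
      \<le> expectation (\<lambda>\<omega>. sqrt (real N + 1) * sqrt (card (random_semigroup \<omega> \<inter> {..N})))"
  proof (rule integral_mono)
    fix \<omega>
    have "card (random_semigroup \<omega> \<inter> {..N}) \<le> card {..N}" by (rule card_mono) auto
    then have "real (card (random_semigroup \<omega> \<inter> {..N})) \<le> real N + 1" by simp
    then have "sqrt (card (random_semigroup \<omega> \<inter> {..N})) * sqrt (card (random_semigroup \<omega> \<inter> {..N}))
        \<le> sqrt (real N + 1) * sqrt (card (random_semigroup \<omega> \<inter> {..N}))"
      by (intro mult_right_mono real_sqrt_le_mono) auto
    then show "real (card (random_semigroup \<omega> \<inter> {..N}))
        \<le> sqrt (real N + 1) * sqrt (card (random_semigroup \<omega> \<inter> {..N}))" by simp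
  qed (unfold random_semigroup_atMost, (rule integrable_local, simp)+)
  also have "\<dots> = sqrt (real N + 1) * expectation (\<lambda>\<omega>. sqrt (card (random_semigroup \<omega> \<inter> {..N})))"
    by simp
  also have "\<dots> \<le> sqrt (real N + 1) * (exp (2 * p / (1 - x)) / sqrt (x ^ N))"
    using expectation_sqrt_card_le[OF x, of N] x by (intro mult_left_mono) (auto simp: pos_le_divide_eq)
  finally show ?thesis by simp
qed

text \<open>Take \<open>x = 1 - s\<close> with \<open>s = 16 * p / L\<close>. Then
  \<open>exp (2 * p / s)\<close> equals \<open>exp (L / 8)\<close> and
  \<open>1 / sqrt (x ^ N)\<close> is at most the same, in total \<open>p powr (- 1 / 4)\<close>.
  Since \<open>p * N \<ge> 1\<close>, the factor \<open>sqrt (N + 1)\<close> is at most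
  \<open>2 * sqrt p * N\<close>, which leaves the saving \<open>p powr (1 / 4)\<close>.\<close>

lemma expectation_card_semigroup_le:
  assumes L: "L = ln (1 / p)" "16 * p / L \<le> 1 / 2" and N: "1 / p \<le> real N" "real N \<le> L\<^sup>2 / (128 * p)"
  shows "expectation (\<lambda>\<omega>. real (card (random_semigroup \<omega> \<inter> {..N}))) \<le> 2 * p powr (1 / 4) * real N"
proof -
  define s where "s = 16 * p / L"
  have "L > 0" using L p_pos p_less_1 by (simp add: ln_div)
  have s: "0 < s" "s \<le> 1 / 2" using L p_pos \<open>L > 0\<close> by (auto simp: s_def)
  \<comment> \<open>From \<open>ln (1 - s) \<ge> - s - 2 * s^2\<close> and
    \<open>s \<le> 1 / 2\<close>.\<close>
  have "exp (- 2 * s) \<le> 1 - s"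
  proof -
    have "s\<^sup>2 \<le> s / 2" using mult_left_mono[of s "1 / 2" s] s by (simp add: power2_eq_square)
    then have "- 2 * s \<le> ln (1 - s)"
      using ln_one_minus_pos_lower_bound[of s] s by linarith
    then show ?thesis using s by (simp add: ln_ge_iff)
  qed
  then have "exp (- 2 * s) ^ N \<le> (1 - s) ^ N" by (rule power_mono) simp
  moreover have "exp (- 2 * s) ^ N = (exp (- (s * N)))\<^sup>2"
  proof -
    have "real N * (- 2 * s) = 2 * - (s * N)" by simp
    then show ?thesis by (simp only: exp_of_nat_mult[symmetric] of_nat_numeral)
  qed
  ultimately have sq: "exp (- (s * N)) \<le> sqrt ((1 - s) ^ N)"
    by (intro real_le_rsqrt) simp
  have "s * N \<le> s * (L\<^sup>2 / (128 * p))" using N s by (intro mult_left_mono) auto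
  also have "\<dots> = L / 8" using \<open>L > 0\<close> p_pos by (simp add: s_def field_simps power2_eq_square)
  finally have "exp (- (L / 8)) \<le> exp (- (s * N))" by simp
  then have sq': "exp (- (L / 8)) \<le> sqrt ((1 - s) ^ N)" using sq by (rule order.trans)
  have "2 * p / s = L / 8" using \<open>L > 0\<close> p_pos by (simp add: s_def field_simps)
  moreover have "1 - (1 - s) = s" by simp
  ultimately have "expectation (\<lambda>\<omega>. real (card (random_semigroup \<omega> \<inter> {..N})))
    \<le> sqrt (real N + 1) * exp (L / 8) / sqrt ((1 - s) ^ N)"
    using expectation_card_semigroup_le_sqrt[of "1 - s" N] s by (simp only:)
  also have "\<dots> \<le> sqrt (real N + 1) * exp (L / 8) / exp (- (L / 8))"
  proof (rule divide_left_mono[OF sq'])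
    have "0 < sqrt ((1 - s) ^ N)" using s by (intro real_sqrt_gt_zero zero_less_power) linarith
    then show "0 < sqrt ((1 - s) ^ N) * exp (- (L / 8))" by (intro mult_pos_pos exp_gt_zero)
  qed simp
  also have "\<dots> = sqrt (real N + 1) * exp (L / 4)"
  proof -
    have "exp (L / 8) / exp (- (L / 8)) = exp (L / 4)" by (subst exp_diff[symmetric]) simp
    then show ?thesis by (simp only: times_divide_eq_right[symmetric])
  qed
  also have "exp (L / 4) = p powr (- 1 / 4)"
    using p_pos by (simp add: L(1) powr_def ln_div)
  finally have le: "expectation (\<lambda>\<omega>. real (card (random_semigroup \<omega> \<inter> {..N})))
    \<le> sqrt (real N + 1) * p powr (- 1 / 4)" .
  have "sqrt (real N + 1) \<le> 2 * sqrt p * real N"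
  proof (rule real_le_lsqrt)
    have "1 \<le> p * real N" using N(1) p_pos by (simp add: field_simps)
    moreover have "p * real N \<le> 1 * real N" using p_less_1 by (intro mult_right_mono) auto
    ultimately have "real N \<ge> 1" by linarith
    have "real N + 1 \<le> 4 * real N" using \<open>real N \<ge> 1\<close> by simp
    also have "\<dots> \<le> 4 * real N * (p * real N)" using mult_left_mono[OF \<open>1 \<le> p * real N\<close>, of "4 * real N"] by simp
    also have "\<dots> = (2 * sqrt p * real N)\<^sup>2" using p_pos by (simp add: power_mult_distrib power2_eq_square[of "real N"])
    finally show "real N + 1 \<le> (2 * sqrt p * real N)\<^sup>2" .
  qed (use p_pos in auto)
  then have "sqrt (real N + 1) * p powr (- 1 / 4) \<le> 2 * sqrt p * real N * p powr (- 1 / 4)"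
    by (rule mult_right_mono) simp
  also have "2 * sqrt p * real N * p powr (- 1 / 4) = 2 * (p powr (1 / 2) * p powr (- 1 / 4)) * real N"
    using p_pos by (simp add: powr_half_sqrt)
  also have "p powr (1 / 2) * p powr (- 1 / 4) = p powr (1 / 4)"
    by (subst powr_add[symmetric]) simp
  finally show ?thesis by (rule order.trans[OF le])
qed

lemma redundant_local: "redundant N (random_set \<omega>) = redundant N (random_set \<omega> \<inter> {..N})"
proof -
  have "random_set \<omega> \<inter> {..N} \<inter> {..<a} = random_set \<omega> \<inter> {..<a}" if "a \<le> N" for a
    using that by auto
  then show ?thesis by (auto simp: redundant_def)
qed

text \<open>Whether \<open>a\<close> is a sum of smaller elements of the random set is independent
  of whether \<open>a\<close> is chosen. So \<open>a\<close> is redundant with probability at most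
  \<open>p\<close> times that of lying in the semigroup, and this is summed over
  \<open>a\<close>.\<close>

lemma expectation_redundant_le:
  "expectation (\<lambda>\<omega>. real (card (redundant N (random_set \<omega>))))
    \<le> p * expectation (\<lambda>\<omega>. real (card (random_semigroup \<omega> \<inter> {..N})))"
proof -
  define E where "E a = {\<omega> \<in> space M. a \<in> random_set \<omega> \<and> a \<in> semigroup_span (random_set \<omega> \<inter> {..<a})}" for a
  define D where "D a = {\<omega> \<in> space M. a \<in> semigroup_span (random_set \<omega> \<inter> {..a})}" for a
  have events: "E a \<in> events" "D a \<in> events" for a
  proof -
    have "E a = {\<omega> \<in> space M. a \<in> random_set \<omega> \<inter> {..a} \<and> a \<in> semigroup_span (random_set \<omega> \<inter> {..a} \<inter> {..<a})}"
    proof -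
      have "{..a} \<inter> {..<a} = {..<a}" by auto
      then show ?thesis by (simp add: E_def Int_assoc)
    qed
    also have "\<dots> \<in> events" by (rule sets_local) simp
    finally show "E a \<in> events" .
    show "D a \<in> events" unfolding D_def by (rule sets_local) simp
  qed
  have le: "prob (E a) \<le> p * prob (D a)" if "a \<in> {1..N}" for a
  proof -
    have "prob (E a) = p * prob {\<omega> \<in> space M. a \<in> semigroup_span (random_set \<omega> \<inter> {..<a})}"
      unfolding E_def by (rule prob_insert_local) (use that in simp)
    also have "\<dots> \<le> p * prob (D a)"
    proof (intro mult_left_mono finite_measure_mono events)
      have "semigroup_span (random_set \<omega> \<inter> {..<a}) \<subseteq> semigroup_span (random_set \<omega> \<inter> {..a})" for \<omega>
        by (rule span_mono) auto
      then show "{\<omega> \<in> space M. a \<in> semigroup_span (random_set \<omega> \<inter> {..<a})} \<subseteq> D a"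
        unfolding D_def by auto
    qed (use p_pos in simp)
    finally show ?thesis .
  qed
  have "expectation (\<lambda>\<omega>. real (card (redundant N (random_set \<omega>)))) = expectation (\<lambda>\<omega>. \<Sum>a\<in>{1..N}. indicator (E a) \<omega>)"
  proof (rule Bochner_Integration.integral_cong[OF refl])
    fix \<omega> assume "\<omega> \<in> space M"
    then have "redundant N (random_set \<omega>) = {1..N} \<inter> {a. \<omega> \<in> E a}"
      by (auto simp: redundant_def E_def random_set_def)
    then show "real (card (redundant N (random_set \<omega>))) = (\<Sum>a\<in>{1..N}. indicator (E a) \<omega>)"
      by (simp add: indicator_def sum.If_cases)
  qed
  also have "\<dots> = (\<Sum>a\<in>{1..N}. prob (E a))"
    using events by (subst Bochner_Integration.integral_sum) (auto simp: integrable_indicator_iff emeasure_eq_measure)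
  also have "\<dots> \<le> (\<Sum>a\<in>{1..N}. p * prob (D a))"
    using le by (rule sum_mono)
  also have "\<dots> = p * (\<Sum>a\<in>{1..N}. prob (D a))"
    by (simp add: sum_distrib_left)
  also have "(\<Sum>a\<in>{1..N}. prob (D a)) = expectation (\<lambda>\<omega>. \<Sum>a\<in>{1..N}. indicator (D a) \<omega>)"
    using events by (subst Bochner_Integration.integral_sum) (auto simp: integrable_indicator_iff emeasure_eq_measure)
  also have "p * \<dots> \<le> p * expectation (\<lambda>\<omega>. real (card (random_semigroup \<omega> \<inter> {..N})))"
  proof (intro mult_left_mono integral_mono)
    show "integrable M (\<lambda>\<omega>. \<Sum>a\<in>{1..N}. indicat_real (D a) \<omega>)"
      using events by (intro Bochner_Integration.integrable_sum) (auto simp: integrable_indicator_iff emeasure_eq_measure)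
    show "integrable M (\<lambda>\<omega>. real (card (random_semigroup \<omega> \<inter> {..N})))"
      unfolding random_semigroup_atMost by (rule integrable_local) simp
    fix \<omega> assume "\<omega> \<in> space M"
    then have "{1..N} \<inter> {a. \<omega> \<in> D a} \<subseteq> random_semigroup \<omega> \<inter> {..N}"
      by (auto simp: D_def mem_random_semigroup_iff[OF order_refl])
    then have "card ({1..N} \<inter> {a. \<omega> \<in> D a}) \<le> card (random_semigroup \<omega> \<inter> {..N})"
      by (rule card_mono[rotated]) simp
    then show "(\<Sum>a\<in>{1..N}. indicator (D a) \<omega>) \<le> real (card (random_semigroup \<omega> \<inter> {..N}))"
      by (simp add: indicator_def sum.If_cases)
  qed (use p_pos in simp)
  finally show ?thesis .
qed

end

section \<open>Subset sums modulo m\<close>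

fun subset_sums_mod :: "nat \<Rightarrow> nat list \<Rightarrow> nat set" where
  "subset_sums_mod m [] = {0}"
| "subset_sums_mod m (x # xs) = subset_sums_mod m xs \<union> (\<lambda>h. (h + x) mod m) ` subset_sums_mod m xs"

lemma subset_sums_mod_subset: "0 < m \<Longrightarrow> subset_sums_mod m xs \<subseteq> {..<m}"
  by (induction xs) auto

lemma subset_sums_mod_nonempty: "subset_sums_mod m xs \<noteq> {}"
  by (induction xs) auto

text \<open>Every list entry is used at most once, so a residue class is reached by an actual sum no
  larger than the sum of the list.\<close>

lemma subset_sums_mod_lift:
  assumes "r \<in> subset_sums_mod m xs" "0 < m"
  shows "\<exists>s. s \<in> semigroup_span (set xs) \<and> s mod m = r \<and> s \<le> sum_list xs"
  using assms(1)
proof (induction xs arbitrary: r)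
  case Nil
  then show ?case by (auto intro!: exI[of _ 0])
next
  case (Cons x xs)
  have mono: "semigroup_span (set xs) \<subseteq> semigroup_span (set (x # xs))"
    by (rule span_mono) auto
  from Cons.prems consider "r \<in> subset_sums_mod m xs"
    | h where "h \<in> subset_sums_mod m xs" "r = (h + x) mod m" by auto
  then show ?case
  proof cases
    case 1
    then show ?thesis using Cons.IH mono by fastforce
  next
    case 2
    from Cons.IH[OF 2(1)] obtain s where s: "s \<in> semigroup_span (set xs)" "s mod m = h" "s \<le> sum_list xs"
      by blast
    have "s + x \<in> semigroup_span (set (x # xs))"
    proof (rule span_add)
      show "x \<in> semigroup_span (set (x # xs))" by (rule span_base) simp
    qed (use s(1) mono in auto)
    then show ?thesis
      using s 2(2) by (intro exI[of _ "s + x"]) (auto simp: mod_simps)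
  qed
qed

text \<open>The list supplies some \<open>s \<le> n\<close> congruent to \<open>n\<close> modulo
  \<open>m\<close>, and copies of the generator \<open>m\<close> fill the difference.\<close>

lemma covering_list_span:
  assumes m: "m \<in> A" "0 < m" "m \<le> R" and xs: "set xs \<subseteq> A \<inter> {..R}"
    and cover: "subset_sums_mod m xs = {..<m}" and n: "length xs * R \<le> n"
  shows "n \<in> semigroup_span (A \<inter> {..R})"
proof -
  have "n mod m \<in> subset_sums_mod m xs" using m cover by simp
  then obtain s where s: "s \<in> semigroup_span (set xs)" "s mod m = n mod m" "s \<le> sum_list xs"
    using subset_sums_mod_lift m(2) by blast
  have "sum_list xs \<le> length xs * R"
    using xs by (induction xs) auto
  then have "s \<le> n" using s(3) n by linarith
  then have "m dvd n - s" using s(2) by (metis mod_eq_dvd_iff_nat)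
  then obtain t where "n - s = t * m" by (metis dvd_div_mult_self)
  then have "n = s + t * m" using \<open>s \<le> n\<close> by simp
  moreover have "s \<in> semigroup_span (A \<inter> {..R})" using s(1) span_mono[OF xs] by blast
  moreover have "t * m \<in> semigroup_span (A \<inter> {..R})" using m by (intro span_mult span_base) simp
  ultimately show ?thesis by (simp add: span_add)
qed

section \<open>Random shifts and noncovering lists\<close>

text \<open>For nonempty \<open>H\<close> inside \<open>{..<m}\<close> with \<open>m > 0\<close>
  this potential is nonnegative, and it vanishes exactly when \<open>H\<close> is all of
  \<open>{..<m}\<close>. It starts at \<open>m - 1\<close> for a singleton.\<close>

definition deficit :: "nat \<Rightarrow> nat set \<Rightarrow> real" where
  "deficit m H = real m / real (card H) - 1"

text \<open>
  For \<open>h \<le> a \<le> 2h\<close> the convex function \<open>1 / a\<close> lies below its chord \<open>(3h - a) / (2h\<^sup>2)\<close>, so that only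
  the average size of \<open>H \<union> (H + x)\<close> matters, and this is \<open>2h - h\<^sup>2 / m\<close>.
\<close>

lemma sum_deficit_shift_le:
  assumes H: "H \<subseteq> {..<m}" "H \<noteq> {}" and m: "0 < m"
  shows "(\<Sum>x<m. deficit m (H \<union> (\<lambda>h. (h + x) mod m) ` H)) \<le> real m / 2 * deficit m H"
proof -
  define T where "T x = (\<lambda>h. (h + x) mod m)" for x
  define h where "h = card H"
  have fin: "finite H" using H(1) finite_subset by blast
  then have h: "0 < h" using H(2) by (simp add: h_def card_gt_0_iff)
  have inj: "inj_on (T x) {..<m}" for x
  proof (rule linorder_inj_onI)
    fix a b assume ab: "a < b" "a \<in> {..<m}" "b \<in> {..<m}"
    show "T x a \<noteq> T x b"
    proof
      assume "T x a = T x b"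
      then have "m dvd (b + x) - (a + x)"
        using ab(1) mod_eq_dvd_iff_nat[of "a + x" "b + x" m] by (simp add: T_def)
      then have "m dvd b - a" by simp
      then show False using ab by (auto dest!: dvd_imp_le)
    qed
  qed auto
  have surj: "T x ` {..<m} = {..<m}" for x
    by (rule endo_inj_surj) (use inj m in \<open>auto simp: T_def\<close>)
  have swap: "T x y = T y x" for x y by (simp add: T_def add.commute)
  have cardT: "card (T x ` H) = h" for x
    using inj_on_subset[OF inj H(1)] by (simp add: h_def card_image)
  \<comment> \<open>Double counting: for fixed \<open>y\<close> in \<open>H\<close> the shifts
    \<open>x\<close> permute the residues, so exactly \<open>h\<close> of them send \<open>y\<close>
    into \<open>H\<close>.\<close>
  have inter: "(\<Sum>x<m. card (H \<inter> T x ` H)) = h * h"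
  proof -
    have "card (H \<inter> T x ` H) = (\<Sum>y\<in>H. of_bool (T x y \<in> H))" for x
    proof -
      have "H \<inter> T x ` H = T x ` {y \<in> H. T x y \<in> H}" by auto
      moreover have "inj_on (T x) {y \<in> H. T x y \<in> H}" 
        by (rule inj_on_subset[OF inj]) (use H(1) in auto)
      ultimately have "card (H \<inter> T x ` H) = card {y \<in> H. T x y \<in> H}" by (simp add: card_image)
      then show ?thesis using fin by (simp add: Int_def)
    qed
    then have "(\<Sum>x<m. card (H \<inter> T x ` H)) = (\<Sum>y\<in>H. \<Sum>x<m. of_bool (T x y \<in> H))"
      by (simp only:) (rule sum.swap)
    also have "\<dots> = (\<Sum>y\<in>H. h)"
    proof (rule sum.cong[OF refl])
      fix y
      have "(\<Sum>x<m. of_bool (T x y \<in> H)) = (\<Sum>x<m. of_bool (T y x \<in> H))" by (simp add: swap[of _ y])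
      also have "\<dots> = (\<Sum>z\<in>T y ` {..<m}. of_bool (z \<in> H))" using inj by (simp add: sum.reindex)
      also have "\<dots> = card ({..<m} \<inter> H)" by (simp add: surj)
      also have "{..<m} \<inter> H = H" using H(1) by auto
      finally show "(\<Sum>x<m. of_bool (T x y \<in> H)) = h" by (simp add: h_def)
    qed
    finally show ?thesis by (simp add: h_def)
  qed
  have le: "deficit m (H \<union> T x ` H) \<le> real m * (h + card (H \<inter> T x ` H)) / (2 * h\<^sup>2) - 1" for x
  proof -
    define a where "a = card (H \<union> T x ` H)"
    define i where "i = card (H \<inter> T x ` H)"
    have ai: "a + i = 2 * h"
      using card_Un_Int[OF fin finite_imageI[OF fin], of "T x"] cardT[of x] by (simp add: a_def i_def h_def)
    have "h \<le> a" unfolding h_def a_def by (rule card_mono) (use fin in auto)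
    have ai': "real i = 2 * real h - real a" using ai by linarith
    have "0 \<le> (real a - h) * (2 * h - real a)"
      using \<open>h \<le> a\<close> ai by (intro mult_nonneg_nonneg) auto
    then have "2 * real h ^ 2 \<le> (real h + i) * a"
      unfolding ai' by (simp add: algebra_simps power2_eq_square)
    then have "1 / real a \<le> (real h + i) / (2 * h\<^sup>2)"
      using h \<open>h \<le> a\<close> by (simp add: field_simps)
    then have "real m * (1 / real a) \<le> real m * ((real h + i) / (2 * h\<^sup>2))"
      by (rule mult_left_mono) simp
    then show ?thesis by (simp add: deficit_def a_def i_def)
  qed
  have "(\<Sum>x<m. deficit m (H \<union> T x ` H)) \<le> (\<Sum>x<m. real m * (h + card (H \<inter> T x ` H)) / (2 * h\<^sup>2) - 1)"
    by (rule sum_mono) (rule le)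
  also have "\<dots> = real m / (2 * h\<^sup>2) * (\<Sum>x<m. real (h + card (H \<inter> T x ` H))) - m"
    by (simp add: sum_subtractf sum_distrib_left)
  also have "(\<Sum>x<m. real (h + card (H \<inter> T x ` H))) = real m * h + real (\<Sum>x<m. card (H \<inter> T x ` H))"
    by (simp add: sum.distrib)
  also have "\<dots> = real m * h + h * h" by (simp add: inter)
  also have "real m / (2 * h\<^sup>2) * (real m * h + h * h) - m = real m / 2 * (real m / h - 1)"
    using h by (simp add: field_simps power2_eq_square)
  finally show ?thesis by (simp add: deficit_def T_def h_def)
qed

text \<open>A uniform element of \<open>{1..q * m}\<close> is uniform modulo \<open>m\<close>.
  Moving the range to start at 0 is harmless, as both ends have residue 0.\<close>

lemma sum_mod_blocks:
  fixes f :: "nat \<Rightarrow> real"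
  shows "(\<Sum>x\<in>{1..q * m}. f (x mod m)) = real q * (\<Sum>x<m. f x)"
proof -
  have shift: "(\<Sum>x\<in>{1..q * m}. f (x mod m)) = (\<Sum>x<q * m. f (x mod m))"
  proof -
    have "f (0 mod m) + (\<Sum>x<q * m. f (Suc x mod m)) = (\<Sum>x<Suc (q * m). f (x mod m))"
      by (simp add: sum.lessThan_Suc_shift del: sum.lessThan_Suc)
    also have "\<dots> = (\<Sum>x<q * m. f (x mod m)) + f (0 mod m)" by simp
    finally show ?thesis by (simp add: sum.atLeast1_atMost_eq)
  qed
  have "(\<Sum>x<q * m. f (x mod m)) = (\<Sum>i<q. \<Sum>x\<in>{i * m..<i * m + m}. f (x mod m))"
    by (rule sum.nat_group[symmetric])
  also have "\<dots> = (\<Sum>i<q. \<Sum>x<m. f x)"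
  proof (rule sum.cong[OF refl])
    fix i
    have "(\<Sum>x\<in>{i * m..<i * m + m}. f (x mod m)) = (\<Sum>x\<in>{0..<m}. f ((x + i * m) mod m))"
      using sum.shift_bounds_nat_ivl[of "\<lambda>x. f (x mod m)" 0 "i * m" m] by (simp add: add.commute)
    then show "(\<Sum>x\<in>{i * m..<i * m + m}. f (x mod m)) = (\<Sum>x<m. f x)"
      by (simp add: lessThan_atLeast0)
  qed
  finally show ?thesis using shift by simp
qed

text \<open>An unnormalized expectation over lists with repetitions, whose entries are thus
  independent and uniform. Each prepended entry contributes \<open>q * m\<close> choices and halves
  the average deficit.\<close>

lemma sum_deficit_lists_le:
  assumes m: "0 < m"
  shows "(\<Sum>xs | set xs \<subseteq> {1..q * m} \<and> length xs = k. deficit m (subset_sums_mod m xs))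
    \<le> (real (q * m) / 2) ^ k * (real m - 1)"
proof (induction k)
  case 0
  have "{xs. set xs \<subseteq> {1..q * m} \<and> length xs = 0} = {[]}" by auto
  then show ?case by (simp add: deficit_def)
next
  case (Suc k)
  let ?X = "{xs. set xs \<subseteq> {1..q * m} \<and> length xs = k}"
  have "(\<Sum>xs | set xs \<subseteq> {1..q * m} \<and> length xs = Suc k. deficit m (subset_sums_mod m xs))
      = (\<Sum>(xs, x)\<in>?X \<times> {1..q * m}. deficit m (subset_sums_mod m (x # xs)))"
    unfolding lists_length_Suc_eq
    by (subst sum.reindex) (auto simp: inj_on_def o_def case_prod_unfold)
  also have "\<dots> = (\<Sum>xs\<in>?X. \<Sum>x\<in>{1..q * m}. deficit m (subset_sums_mod m (x # xs)))"
    by (simp only: sum.cartesian_product)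
  also have "\<dots> \<le> (\<Sum>xs\<in>?X. real (q * m) / 2 * deficit m (subset_sums_mod m xs))"
  proof (rule sum_mono)
    fix xs
    let ?H = "subset_sums_mod m xs"
    have "(\<Sum>x\<in>{1..q * m}. deficit m (subset_sums_mod m (x # xs)))
        = (\<Sum>x\<in>{1..q * m}. deficit m (?H \<union> (\<lambda>h. (h + x mod m) mod m) ` ?H))"
      by (simp add: mod_simps)
    also have "\<dots> = real q * (\<Sum>x<m. deficit m (?H \<union> (\<lambda>h. (h + x) mod m) ` ?H))"
      by (rule sum_mod_blocks)
    also have "\<dots> \<le> real q * (real m / 2 * deficit m ?H)"
      by (intro mult_left_mono sum_deficit_shift_le subset_sums_mod_subset subset_sums_mod_nonempty m) simp
    finally show "(\<Sum>x\<in>{1..q * m}. deficit m (subset_sums_mod m (x # xs))) \<le> real (q * m) / 2 * deficit m ?H"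
      by simp
  qed
  also have "\<dots> = real (q * m) / 2 * (\<Sum>xs\<in>?X. deficit m (subset_sums_mod m xs))"
    by (rule sum_distrib_left[symmetric])
  also have "\<dots> \<le> real (q * m) / 2 * ((real (q * m) / 2) ^ k * (real m - 1))"
    using Suc by (rule mult_left_mono) simp
  finally show ?case by (simp only: power_Suc mult.assoc)
qed

text \<open>Markov's inequality: a noncovering list misses a residue, so its deficit is at least
  \<open>1 / m\<close>.\<close>

lemma card_noncovering_lists_le:
  assumes m: "0 < m"
  shows "real (card {xs. set xs \<subseteq> {1..q * m} \<and> length xs = k \<and> subset_sums_mod m xs \<noteq> {..<m}})
    \<le> real m ^ 2 * (real (q * m) / 2) ^ k"
proof -
  let ?X = "{xs. set xs \<subseteq> {1..q * m} \<and> length xs = k}"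
  let ?B = "{xs. set xs \<subseteq> {1..q * m} \<and> length xs = k \<and> subset_sums_mod m xs \<noteq> {..<m}}"
  have fin: "finite ?X" by (rule finite_lists_length_eq) simp
  have card: "0 < card (subset_sums_mod m xs)" "card (subset_sums_mod m xs) \<le> m" for xs
    using subset_sums_mod_subset[OF m, of xs] subset_sums_mod_nonempty[of m xs] finite_subset[of _ "{..<m}"]
      card_mono[of "{..<m}" "subset_sums_mod m xs"] by (auto simp: card_gt_0_iff)
  have "real (card ?B) = (\<Sum>xs\<in>?B. 1)" by simp
  also have "\<dots> \<le> (\<Sum>xs\<in>?B. real m * deficit m (subset_sums_mod m xs))"
  proof (rule sum_mono)
    fix xs assume "xs \<in> ?B"
    then have "subset_sums_mod m xs \<subset> {..<m}" using subset_sums_mod_subset[OF m] by auto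
    then have "card (subset_sums_mod m xs) < m" using psubset_card_mono[of "{..<m}"] by simp
    then have "real (card (subset_sums_mod m xs)) \<le> real m - 1" by linarith
    \<comment> \<open>Multiplying by \<open>m + 1\<close> avoids a division by \<open>m - 1\<close>,
      which is zero for \<open>m = 1\<close>.\<close>
    then have "real (card (subset_sums_mod m xs)) * (real m + 1) \<le> (real m - 1) * (real m + 1)"
      by (rule mult_right_mono) simp
    also have "\<dots> \<le> real m * real m" by (simp add: algebra_simps)
    finally have "real m + 1 \<le> real m * real m / real (card (subset_sums_mod m xs))"
      using card(1)[of xs] by (simp add: pos_le_divide_eq mult.commute)
    then show "1 \<le> real m * deficit m (subset_sums_mod m xs)"
      by (simp add: deficit_def algebra_simps)
  qed
  also have "\<dots> \<le> (\<Sum>xs\<in>?X. real m * deficit m (subset_sums_mod m xs))"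
    using card by (intro sum_mono2 fin) (auto simp: deficit_def pos_le_divide_eq)
  also have "\<dots> = real m * (\<Sum>xs\<in>?X. deficit m (subset_sums_mod m xs))"
    by (rule sum_distrib_left[symmetric])
  also have "\<dots> \<le> real m * ((real (q * m) / 2) ^ k * (real m - 1))"
    by (intro mult_left_mono sum_deficit_lists_le m) simp
  also have "\<dots> \<le> real m * ((real (q * m) / 2) ^ k * real m)"
    by (intro mult_left_mono) auto
  finally show ?thesis by (simp add: power2_eq_square mult_ac)
qed

section \<open>The conductor of a random semigroup\<close>

text \<open>Only generators up to \<open>D\<close> are allowed. This makes the event depend on
  finitely many coordinates and also excludes minimal generators beyond \<open>D\<close>.\<close>

definition covers_from :: "nat \<Rightarrow> nat set \<Rightarrow> bool" where
  "covers_from D A \<longleftrightarrow> (\<forall>n\<ge>D. n \<in> semigroup_span (A \<inter> {..D}))"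

text \<open>Lists are distinct so that one of length \<open>k\<close> lies in the random set with
  probability at most \<open>p ^ k\<close>.\<close>

definition noncovering :: "nat \<Rightarrow> nat \<Rightarrow> nat set \<Rightarrow> bool" where
  "noncovering m k X \<longleftrightarrow> (\<forall>xs. set xs \<subseteq> X \<and> distinct xs \<and> length xs = k \<longrightarrow> subset_sums_mod m xs \<noteq> {..<m})"

text \<open>The number of distinct lists is a falling factorial, with \<open>k\<close> factors all
  larger than \<open>card X - k\<close>.\<close>

lemma power_le_card_distinct_lists:
  assumes "finite X" "k \<le> card X"
  shows "(card X - k) ^ k \<le> card {xs. length xs = k \<and> distinct xs \<and> set xs \<subseteq> X}"
proof -
  have "(card X - k) ^ k = (\<Prod>i\<in>{card X - k + 1..card X}. card X - k)"
    using assms(2) by simp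
  also have "\<dots> \<le> \<Prod>{card X - k + 1..card X}" by (rule prod_mono) auto
  finally show ?thesis by (simp add: card_lists_distinct_length_eq[OF assms])
qed

text \<open>One term of the exponential series. It later absorbs the cube of the list length coming
  from \<open>R ^ 3\<close>.\<close>

lemma exp_ge_cube:
  fixes x :: real
  assumes "0 \<le> x"
  shows "x ^ 3 / 6 \<le> exp x"
proof -
  have "x ^ 3 /\<^sub>R fact 3 \<le> (\<Sum>n. x ^ n /\<^sub>R fact n)"
    using sum_le_suminf[OF summable_exp_generic[of x], of "{3}"] assms by simp
  then show ?thesis by (simp add: exp_def fact_numeral)
qed

text \<open>Brings the Chernoff error \<open>exp (- 5 / 2 * k)\<close> to the base
  \<open>15 / 17\<close> of the first moment bound.\<close>

lemma exp_le_base: "exp (- (5 / 2)) \<le> (15 / 17 :: real)"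
proof -
  have "1 + 5 / 2 \<le> exp (5 / 2 :: real)" by (rule exp_ge_add_one_self)
  then show ?thesis by (simp add: exp_minus field_simps)
qed

context bernoulli_set
begin

text \<open>
  First moment bound for the number \<open>Z\<close> of noncovering lists of \<open>k\<close> distinct elements: on the event all
  lists are noncovering, so that \<open>Z \<ge> (17\<mu> / 30) ^ k\<close>, while the expectation is at most \<open>m\<^sup>2 (\<mu> / 2) ^ k\<close>.
\<close>

lemma prob_noncovering_le:
  assumes m: "0 < m" and k: "30 * real k \<le> p * real (q * m)"
  shows "prob {\<omega> \<in> space M. 3 / 5 * (p * real (q * m)) \<le> card (random_set \<omega> \<inter> {1..q * m})
      \<and> noncovering m k (random_set \<omega> \<inter> {1..q * m})} \<le> real m ^ 2 * (15 / 17) ^ k"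
    (is "prob ?E \<le> _")
proof (cases "k = 0")
  \<comment> \<open>For \<open>k = 0\<close> the right side is at least 1; otherwise the assumption
    on \<open>k\<close> makes the mean positive.\<close>
  case True
  have "1 \<le> real m ^ 2" using m by simp
  then show ?thesis using True prob_le_1[of ?E] by (simp only: power_0 mult_1_right)
next
  case False
  define J where "J = {1..q * m}"
  define \<mu> where "\<mu> = p * real (q * m)"
  define \<B> where "\<B> = {xs. set xs \<subseteq> J \<and> length xs = k \<and> subset_sums_mod m xs \<noteq> {..<m}}"
  define \<D> where "\<D> = {xs \<in> \<B>. distinct xs}"
  define Z where "Z \<omega> = real (card {xs \<in> \<D>. set xs \<subseteq> random_set \<omega> \<inter> J})" for \<omega>
  have finJ: "finite J" by (simp add: J_def)
  have "finite {xs. set xs \<subseteq> J \<and> length xs = k}" using finJ by (rule finite_lists_length_eq)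
  then have fin: "finite \<B>" "finite \<D>" unfolding \<B>_def \<D>_def by (auto elim: rev_finite_subset)
  have \<mu>: "30 * real k \<le> \<mu>" "0 < \<mu>" using k False by (auto simp: \<mu>_def)
  have intZ: "integrable M Z" unfolding Z_def by (rule integrable_local[OF finJ])
  have nonneg: "0 \<le> Z \<omega>" for \<omega> by (simp add: Z_def)
  \<comment> \<open>With at least \<open>3 / 5 * \<mu>\<close> elements and
    \<open>k \<le> \<mu> / 30\<close>, each factor is at least
    \<open>(3 / 5 - 1 / 30) * \<mu> = 17 / 30 * \<mu>\<close>. The final base is
    \<open>(1 / 2) / (17 / 30) = 15 / 17\<close>.\<close>
  define t where "t = (17 / 30 * \<mu>) ^ k"
  have "0 < t" using \<mu> by (simp add: t_def)
  have sub: "?E \<subseteq> {\<omega> \<in> space M. t \<le> Z \<omega>}"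
  proof safe
    fix \<omega> assume c: "3 / 5 * (p * real (q * m)) \<le> card (random_set \<omega> \<inter> {1..q * m})"
      and nc: "noncovering m k (random_set \<omega> \<inter> {1..q * m})"
    let ?X = "random_set \<omega> \<inter> J"
    have c': "3 / 5 * \<mu> \<le> real (card ?X)" using c by (simp add: \<mu>_def J_def)
    then have kc: "k \<le> card ?X" using \<mu> by linarith
    have "t \<le> real (card ?X - k) ^ k"
      unfolding t_def by (rule power_mono) (use c' kc \<mu> in auto)
    also have "\<dots> \<le> card {xs. length xs = k \<and> distinct xs \<and> set xs \<subseteq> ?X}"
      using power_le_card_distinct_lists[of ?X k] finJ kc by (simp only: of_nat_le_iff of_nat_power[symmetric]) simp
    also have "{xs. length xs = k \<and> distinct xs \<and> set xs \<subseteq> ?X} = {xs \<in> \<D>. set xs \<subseteq> ?X}"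
      using nc by (auto simp: \<D>_def \<B>_def noncovering_def J_def)
    finally show "t \<le> Z \<omega>" by (simp add: Z_def)
  qed
  have "prob ?E \<le> prob {\<omega> \<in> space M. t \<le> Z \<omega>}"
    by (rule finite_measure_mono[OF sub]) (unfold Z_def, rule sets_local[OF finJ])
  also have "\<dots> \<le> expectation Z / t"
    by (rule integral_Markov_inequality_measure[where A = "{}"]) (use intZ nonneg \<open>0 < t\<close> in auto)
  also have "expectation Z \<le> real (card \<B>) * p ^ k"
  proof -
    have ev: "{\<omega> \<in> space M. set xs \<subseteq> random_set \<omega>} \<in> events" for xs :: "nat list"
    proof -
      have "{\<omega> \<in> space M. set xs \<subseteq> random_set \<omega>} = {\<omega> \<in> space M. set xs \<subseteq> random_set \<omega> \<inter> set xs}" by auto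
      then show ?thesis using sets_local[of "set xs" "\<lambda>X. set xs \<subseteq> X"] by simp
    qed
    have "expectation Z = expectation (\<lambda>\<omega>. \<Sum>xs\<in>\<D>. indicator {\<omega> \<in> space M. set xs \<subseteq> random_set \<omega>} \<omega>)"
    proof (rule Bochner_Integration.integral_cong[OF refl])
      fix \<omega> assume \<omega>: "\<omega> \<in> space M"
      have "{xs \<in> \<D>. set xs \<subseteq> random_set \<omega> \<inter> J} = \<D> \<inter> {xs. set xs \<subseteq> random_set \<omega>}"
        by (auto simp: \<D>_def \<B>_def)
      then show "Z \<omega> = (\<Sum>xs\<in>\<D>. indicator {\<omega> \<in> space M. set xs \<subseteq> random_set \<omega>} \<omega>)"
        using \<omega> fin by (simp add: Z_def indicator_def sum.If_cases)
    qed
    also have "\<dots> = (\<Sum>xs\<in>\<D>. prob {\<omega> \<in> space M. set xs \<subseteq> random_set \<omega>})"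
      using ev by (subst Bochner_Integration.integral_sum) (auto simp: integrable_indicator_iff emeasure_eq_measure)
    also have "\<dots> \<le> (\<Sum>xs\<in>\<D>. p ^ k)"
    proof (rule sum_mono)
      fix xs assume "xs \<in> \<D>"
      then have "card (set xs) = k" by (simp add: \<D>_def \<B>_def distinct_card)
      then show "prob {\<omega> \<in> space M. set xs \<subseteq> random_set \<omega>} \<le> p ^ k"
        using prob_subset_random_set_le[of "set xs"] by simp
    qed
    also have "\<dots> = real (card \<D>) * p ^ k" by simp
    \<comment> \<open>Dropping distinctness gives access to the count of lists with
      repetitions.\<close>
    also have "\<dots> \<le> real (card \<B>) * p ^ k"
      using fin p_pos by (intro mult_right_mono) (auto simp: \<D>_def intro: card_mono)
    finally show ?thesis .
  qed
  also have "real (card \<B>) * p ^ k \<le> real m ^ 2 * (real (q * m) / 2) ^ k * p ^ k"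
    using card_noncovering_lists_le[OF m, of q k] p_pos
    by (intro mult_right_mono) (auto simp: \<B>_def J_def)
  also have "\<dots> = real m ^ 2 * (\<mu> / 2) ^ k"
    by (simp add: \<mu>_def power_mult_distrib[symmetric] mult_ac)
  also have "real m ^ 2 * (\<mu> / 2) ^ k / t = real m ^ 2 * (15 / 17) ^ k"
  proof -
    have "(\<mu> / 2) ^ k / t = ((\<mu> / 2) / (17 / 30 * \<mu>)) ^ k" by (simp only: t_def power_divide)
    also have "(\<mu> / 2) / (17 / 30 * \<mu>) = 15 / 17" using \<mu> by simp
    finally show ?thesis by (simp only: times_divide_eq_right[symmetric])
  qed
  finally show ?thesis using \<open>0 < t\<close> by (simp add: divide_right_mono)
qed


lemma covers_from_local: "covers_from D (A \<inter> {..D}) \<longleftrightarrow> covers_from D A"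
  by (simp add: covers_from_def)

lemma sets_covers_from: "{\<omega> \<in> space M. \<not> covers_from D (random_set \<omega>)} \<in> events"
proof -
  have "{\<omega> \<in> space M. \<not> covers_from D (random_set \<omega> \<inter> {..D})} \<in> events" by (rule sets_local) simp
  then show ?thesis by (simp only: covers_from_local)
qed

text \<open>The modulus is an element of the random set itself, so a union bound over all
  \<open>m \<le> R\<close> removes the dependence. Each \<open>m\<close> uses the block up to a
  multiple of \<open>m\<close>, where residues are uniform. The bad events are: too few elements up
  to \<open>R\<close>, too few in a block, no covering list in a block with enough elements.\<close>

lemma prob_not_covers_from_le:
  assumes k: "0 < k" "60 * real k \<le> p * real R"
  shows "prob {\<omega> \<in> space M. \<not> covers_from (k * R) (random_set \<omega>)} \<le> 3 * real R ^ 3 * (15 / 17) ^ k"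
proof -
  define J where "J m = {1..R div m * m}" for m
  define E0 where "E0 = {\<omega> \<in> space M. real (card (random_set \<omega> \<inter> {1..R})) < 3 / 5 * (p * card {1..R})}"
  define E1 where "E1 m = {\<omega> \<in> space M. real (card (random_set \<omega> \<inter> J m)) < 3 / 5 * (p * card (J m))}" for m
  define E2 where "E2 m = {\<omega> \<in> space M. 3 / 5 * (p * real (R div m * m)) \<le> card (random_set \<omega> \<inter> J m)
      \<and> noncovering m k (random_set \<omega> \<inter> J m)}" for m
  have events: "E0 \<in> events" "E1 m \<in> events" "E2 m \<in> events" for m
    unfolding E0_def E1_def E2_def J_def by (intro sets_local; simp)+
  have R: "0 < R" using k by (cases R) auto
  \<comment> \<open>The largest multiple of \<open>m\<close> up to \<open>R\<close> is at least
    \<open>R / 2\<close>.\<close>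
  have block: "30 * real k \<le> p * real (R div m * m)" if "m \<in> {1..R}" for m
  proof -
    have "R = R div m * m + R mod m" by simp
    moreover have "R mod m < m" using that by simp
    moreover have "m \<le> R div m * m" using that by (simp add: Suc_le_eq div_greater_zero_iff)
    ultimately have "R \<le> 2 * (R div m * m)" by linarith
    then have "real R \<le> 2 * real (R div m * m)" by linarith
    then have "p * real R \<le> p * (2 * real (R div m * m))" using p_pos by (intro mult_left_mono) auto
    then show ?thesis using k(2) by linarith
  qed
  have "{\<omega> \<in> space M. \<not> covers_from (k * R) (random_set \<omega>)} \<subseteq> E0 \<union> (\<Union>m\<in>{1..R}. E1 m \<union> E2 m)"
  proof (safe, rule ccontr)
    fix \<omega> assume \<omega>: "\<omega> \<in> space M" and nc: "\<not> covers_from (k * R) (random_set \<omega>)"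
      and e0: "\<omega> \<notin> E0" and e: "\<omega> \<notin> (\<Union>m\<in>{1..R}. E1 m \<union> E2 m)"
    have "0 < 3 / 5 * (p * card {1..R})" using p_pos R by simp
    also have "\<dots> \<le> real (card (random_set \<omega> \<inter> {1..R}))" using e0 \<omega> by (simp add: E0_def)
    finally have "random_set \<omega> \<inter> {1..R} \<noteq> {}" by (metis card.empty less_irrefl of_nat_0)
    then obtain m where m: "m \<in> random_set \<omega>" "m \<in> {1..R}" by blast
    then have "\<omega> \<notin> E1 m" "\<omega> \<notin> E2 m" using e by auto
    then have "\<not> noncovering m k (random_set \<omega> \<inter> J m)" using \<omega> by (auto simp: E1_def E2_def J_def)
    then obtain xs where xs: "set xs \<subseteq> random_set \<omega> \<inter> J m" "length xs = k" "subset_sums_mod m xs = {..<m}"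
      by (auto simp: noncovering_def)
    have "J m \<subseteq> {..R}" by (auto simp: J_def intro: order.trans[OF _ div_times_less_eq_dividend])
    then have xsR: "set xs \<subseteq> random_set \<omega> \<inter> {..R}" using xs(1) by auto
    have "random_set \<omega> \<inter> {..R} \<subseteq> random_set \<omega> \<inter> {..k * R}"
      using k(1) by (auto intro: order.trans)
    then have "semigroup_span (random_set \<omega> \<inter> {..R}) \<subseteq> semigroup_span (random_set \<omega> \<inter> {..k * R})"
      by (rule span_mono)
    moreover have "n \<in> semigroup_span (random_set \<omega> \<inter> {..R})" if "k * R \<le> n" for n
      using covering_list_span[of m "random_set \<omega>" R xs n] m xs that xsR by simp
    ultimately have "n \<in> semigroup_span (random_set \<omega> \<inter> {..k * R})" if "k * R \<le> n" for n
      using that by blast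
    then show False using nc by (simp add: covers_from_def)
  qed
  then have "prob {\<omega> \<in> space M. \<not> covers_from (k * R) (random_set \<omega>)} \<le> prob (E0 \<union> (\<Union>m\<in>{1..R}. E1 m \<union> E2 m))"
    using events by (intro finite_measure_mono) auto
  also have "\<dots> \<le> prob E0 + prob (\<Union>m\<in>{1..R}. E1 m \<union> E2 m)"
    using events by (intro measure_Un_le) auto
  also have "prob (\<Union>m\<in>{1..R}. E1 m \<union> E2 m) \<le> (\<Sum>m\<in>{1..R}. prob (E1 m \<union> E2 m))"
    using events by (intro finite_measure_subadditive_finite) auto
  also have "\<dots> \<le> (\<Sum>m\<in>{1..R}. (1 + real R ^ 2) * (15 / 17) ^ k)"
  proof (rule sum_mono)
    fix m assume m: "m \<in> {1..R}"
    have "prob (E1 m) \<le> exp (- (p * card (J m)) / 12)"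
      unfolding E1_def by (rule prob_card_lower_tail) (auto simp: J_def)
    also have "\<dots> \<le> exp (real k * (- (5 / 2)))"
      using block[OF m] by (simp add: J_def)
    also have "\<dots> = exp (- (5 / 2)) ^ k" by (rule exp_of_nat_mult)
    also have "\<dots> \<le> (15 / 17) ^ k" by (intro power_mono exp_le_base) simp
    finally have "prob (E1 m) \<le> (15 / 17) ^ k" .
    moreover have "prob (E2 m) \<le> real m ^ 2 * (15 / 17) ^ k"
      unfolding E2_def J_def by (rule prob_noncovering_le) (use m block in auto)
    moreover have "real m ^ 2 * (15 / 17) ^ k \<le> real R ^ 2 * (15 / 17) ^ k"
      using m by (intro mult_right_mono power_mono) auto
    moreover have "prob (E1 m \<union> E2 m) \<le> prob (E1 m) + prob (E2 m)"
      using events by (intro measure_Un_le) auto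
    ultimately show "prob (E1 m \<union> E2 m) \<le> (1 + real R ^ 2) * (15 / 17) ^ k"
      by (simp only: distrib_right)
  qed
  also have "\<dots> = (real R + real R ^ 3) * (15 / 17) ^ k"
    by (simp add: algebra_simps power2_eq_square power3_eq_cube)
  also have "prob E0 \<le> (15 / 17) ^ k"
  proof -
    have "prob E0 \<le> exp (- (p * card {1..R}) / 12)"
      unfolding E0_def by (rule prob_card_lower_tail) auto
    also have "\<dots> \<le> exp (real k * (- (5 / 2)))" using k by simp
    also have "\<dots> = exp (- (5 / 2)) ^ k" by (rule exp_of_nat_mult)
    also have "\<dots> \<le> (15 / 17) ^ k" by (intro power_mono exp_le_base) simp
    finally show ?thesis .
  qed
  also have "(15 / 17) ^ k + (real R + real R ^ 3) * (15 / 17) ^ k = (1 + real R + real R ^ 3) * (15 / 17) ^ k"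
    by (simp add: algebra_simps)
  also have "\<dots> \<le> 3 * real R ^ 3 * (15 / 17) ^ k"
  proof (rule mult_right_mono)
    have "real R ^ 1 \<le> real R ^ 3" using R by (intro power_increasing) auto
    moreover have "1 \<le> real R" using R by simp
    ultimately show "1 + real R + real R ^ 3 \<le> 3 * real R ^ 3" by (simp only: power_one_right)
  qed simp
  finally show ?thesis by simp
qed

text \<open>
  The factor \<open>60\<close> in the window \<open>R\<close> makes \<open>30k\<close> a lower bound for the expected number of elements up to the
  largest multiple of \<open>m\<close> below \<open>R\<close>, for every \<open>m \<le> R\<close>. The factor \<open>100\<close> in \<open>k\<close> makes \<open>(16 / 17) ^ k\<close> smaller than \<open>p ^ (5 (j + 1))\<close>,
  which compensates for \<open>R ^ 3\<close>.
\<close>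

definition list_length_at :: "nat \<Rightarrow> nat" where
  "list_length_at j = (j + 1) * nat \<lceil>100 * ln (1 / p)\<rceil>"

definition window_at :: "nat \<Rightarrow> nat" where
  "window_at j = nat \<lceil>60 * real (list_length_at j) / p\<rceil>"

definition threshold :: "nat \<Rightarrow> nat" where
  "threshold j = list_length_at j * window_at j"

text \<open>The ceiling costs at most 1, which \<open>ln (1 / p) \<ge> 1\<close> turns into the step
  from 100 to 101.\<close>

lemma list_length_at_bounds:
  assumes "1 \<le> ln (1 / p)"
  shows "real (j + 1) * (100 * ln (1 / p)) \<le> list_length_at j"
    and "list_length_at j \<le> real (j + 1) * (101 * ln (1 / p))"
    and "0 < list_length_at j"
proof -
  have "100 * ln (1 / p) \<le> nat \<lceil>100 * ln (1 / p)\<rceil>" "nat \<lceil>100 * ln (1 / p)\<rceil> \<le> 101 * ln (1 / p)"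
    using assms by linarith+
  then have *: "real (j + 1) * (100 * ln (1 / p)) \<le> real (j + 1) * nat \<lceil>100 * ln (1 / p)\<rceil>"
      "real (j + 1) * nat \<lceil>100 * ln (1 / p)\<rceil> \<le> real (j + 1) * (101 * ln (1 / p))"
    by (intro mult_left_mono; simp)+
  then show 1: "real (j + 1) * (100 * ln (1 / p)) \<le> list_length_at j"
    and "list_length_at j \<le> real (j + 1) * (101 * ln (1 / p))"
    unfolding list_length_at_def of_nat_mult by simp_all
  have "0 < real (j + 1) * (100 * ln (1 / p))" using assms by simp
  then show "0 < list_length_at j" using 1 by linarith
qed

lemma window_at_bounds:
  assumes "1 \<le> ln (1 / p)"
  shows "60 * real (list_length_at j) / p \<le> window_at j" "window_at j \<le> 61 * real (list_length_at j) / p"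
proof -
  have "1 \<le> real (list_length_at j) / p"
    using list_length_at_bounds(3)[OF assms, of j] p_pos p_less_1 by (simp add: field_simps)
  then show "60 * real (list_length_at j) / p \<le> window_at j" "window_at j \<le> 61 * real (list_length_at j) / p"
    unfolding window_at_def by linarith+
qed

lemma threshold_le:
  assumes "1 \<le> ln (1 / p)"
  shows "threshold j \<le> real (j + 1) ^ 2 * (630000 * (1 / p) * (ln (1 / p))\<^sup>2)"
proof -
  let ?k = "real (list_length_at j)"
  have "threshold j \<le> ?k * (61 * ?k / p)"
    unfolding threshold_def of_nat_mult by (intro mult_left_mono window_at_bounds assms) simp
  also have "\<dots> = 61 / p * ?k ^ 2" by (simp add: power2_eq_square)
  also have "\<dots> \<le> 61 / p * (real (j + 1) * (101 * ln (1 / p))) ^ 2"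
    using p_pos by (intro mult_left_mono power_mono list_length_at_bounds assms) auto
  \<comment> \<open>Here \<open>622261 = 61 * 101 ^ 2\<close>.\<close>
  also have "\<dots> = real (j + 1) ^ 2 * (622261 * (1 / p) * (ln (1 / p))\<^sup>2)"
    by (simp only: power_mult_distrib) simp
  also have "\<dots> \<le> real (j + 1) ^ 2 * (630000 * (1 / p) * (ln (1 / p))\<^sup>2)"
    using p_pos by (intro mult_left_mono mult_right_mono) auto
  finally show ?thesis .
qed

text \<open>Makes the expected number of elements up to the threshold large enough for the upper
  tail bound, and the threshold positive.\<close>

lemma threshold_ge:
  assumes "1 \<le> ln (1 / p)"
  shows "ln (1 / p) \<le> p * threshold j"
proof -
  let ?k = "real (list_length_at j)"
  have k: "1 \<le> ?k" "ln (1 / p) \<le> ?k"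
  proof -
    have "1 * (100 * ln (1 / p)) \<le> real (j + 1) * (100 * ln (1 / p))"
      using assms by (intro mult_right_mono) auto
    then show "1 \<le> ?k" "ln (1 / p) \<le> ?k" using list_length_at_bounds(1)[OF assms, of j] assms by linarith+
  qed
  have "ln (1 / p) * 1 \<le> ?k * 60" using k by linarith
  also have "\<dots> \<le> ?k * (60 * ?k)" using k by (intro mult_left_mono) auto
  also have "\<dots> = p * (?k * (60 * ?k / p))" using p_pos by simp
  also have "\<dots> \<le> p * (?k * window_at j)"
    using p_pos by (intro mult_left_mono window_at_bounds assms) auto
  finally show ?thesis by (simp add: threshold_def)
qed

text \<open>The list length turns the exponential decay into \<open>p ^ (5 * (j + 1))\<close>. Three
  factors \<open>p\<close> cancel the \<open>p ^ 3\<close> from the cubed window, one beats the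
  numerical constant, one is kept, and the rest gives \<open>(1 / 8) ^ j\<close>.\<close>

lemma prob_not_covers_threshold_le:
  assumes p: "p \<le> 1 / 10 ^ 11" and L: "1 \<le> ln (1 / p)"
  shows "prob {\<omega> \<in> space M. \<not> covers_from (threshold j) (random_set \<omega>)} \<le> p * (1 / 8) ^ j"
proof -
  define k where "k = list_length_at j"
  define R where "R = window_at j"
  note bounds = list_length_at_bounds[OF L, of j, folded k_def] window_at_bounds[OF L, of j, folded k_def R_def]
  have "60 * real k \<le> p * R" using bounds p_pos by (simp add: field_simps)
  then have "prob {\<omega> \<in> space M. \<not> covers_from (threshold j) (random_set \<omega>)} \<le> 3 * real R ^ 3 * (15 / 17) ^ k"
    unfolding threshold_def k_def[symmetric] R_def[symmetric] using bounds(3) by (intro prob_not_covers_from_le)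
  also have "\<dots> \<le> 3 * (61 * real k / p) ^ 3 * (15 / 17) ^ k"
    using bounds by (intro mult_left_mono mult_right_mono power_mono) auto
  also have "\<dots> = 3 * 61 ^ 3 / p ^ 3 * (real k ^ 3 * (15 / 17) ^ k)"
    by (simp add: power_mult_distrib power_divide)
  also have "\<dots> \<le> 3 * 61 ^ 3 / p ^ 3 * (24576 * (1 / p) powr (- 5 * real (j + 1)))"
  proof (rule mult_left_mono)
    \<comment> \<open>The constant is \<open>24576 = 6 * 16 ^ 3\<close>. The cost
      \<open>(16 / 15) ^ k\<close> worsens the base from \<open>15 / 17\<close> to
      \<open>16 / 17\<close>.\<close>
    have "(real k / 16) ^ 3 / 6 \<le> exp (real k / 16)" by (rule exp_ge_cube) simp
    then have "real k ^ 3 \<le> 24576 * exp (real k * (1 / 16))" by (simp add: power_divide)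
    also have "exp (real k * (1 / 16)) = exp (1 / 16) ^ k" by (rule exp_of_nat_mult)
    also have "\<dots> \<le> (16 / 15) ^ k"
    proof (rule power_mono)
      have "1 + (- 1 / 16) \<le> exp (- 1 / 16 :: real)" by (rule exp_ge_add_one_self)
      then show "exp (1 / 16) \<le> (16 / 15 :: real)" by (simp add: exp_minus field_simps)
    qed simp
    finally have "real k ^ 3 * (15 / 17) ^ k \<le> 24576 * (16 / 15) ^ k * (15 / 17) ^ k"
      by (simp add: mult_right_mono)
    also have "\<dots> = 24576 * (16 / 17) ^ k" by (simp add: power_mult_distrib[symmetric])
    also have "(16 / 17 :: real) ^ k \<le> exp (- 1 / 17) ^ k"
    proof (rule power_mono)
      have "1 + (- 1 / 17) \<le> exp (- 1 / 17 :: real)" by (rule exp_ge_add_one_self)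
      then show "16 / 17 \<le> exp (- 1 / 17 :: real)" by simp
    qed simp
    also have "exp (- 1 / 17) ^ k = exp (real k * (- 1 / 17))" by (rule exp_of_nat_mult[symmetric])
    also have "\<dots> \<le> exp (- 5 * real (j + 1) * ln (1 / p))"
    proof -
      \<comment> \<open>Here \<open>85 = 5 * 17\<close>, so \<open>100\<close> leaves room.\<close>
      have "85 * (real (j + 1) * ln (1 / p)) \<le> 100 * (real (j + 1) * ln (1 / p))"
        using L by (intro mult_right_mono) auto
      also have "\<dots> \<le> real k" using bounds(1) by (simp add: mult_ac)
      finally have "real k * (- 1 / 17) \<le> - 5 * (real (j + 1) * ln (1 / p))" by linarith
      then show ?thesis by (simp only: mult.assoc exp_le_cancel_iff)
    qed
    also have "\<dots> = (1 / p) powr (- 5 * real (j + 1))" using p_pos by (simp add: powr_def)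
    finally show "real k ^ 3 * (15 / 17) ^ k \<le> 24576 * (1 / p) powr (- 5 * real (j + 1))" by simp
  qed (use p_pos in simp)
  also have "(1 / p) powr (- 5 * real (j + 1)) = p ^ (5 * (j + 1))"
  proof -
    have "(1 / p) powr (- 5 * real (j + 1)) = p powr real (5 * (j + 1))"
      using p_pos by (simp add: powr_def ln_div algebra_simps)
    then show ?thesis using p_pos by (simp only: powr_realpow)
  qed
  also have "p ^ (5 * (j + 1)) = p ^ 3 * (p * (p * (p ^ 5) ^ j))"
  proof -
    have "5 * (j + 1) = 3 + (1 + (1 + 5 * j))" by simp
    then show ?thesis by (simp only: power_add power_mult power_one_right)
  qed
  also have "3 * 61 ^ 3 / p ^ 3 * (24576 * (p ^ 3 * (p * (p * (p ^ 5) ^ j)))) = (16734855168 * p) * (p * (p ^ 5) ^ j)"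
    using p_pos by simp
  also have "\<dots> \<le> 1 * (p * (1 / 8) ^ j)"
  proof (intro mult_mono power_mono)
    show "16734855168 * p \<le> 1" using p by simp
    have "p ^ 5 \<le> p ^ 1" using p_pos p_less_1 by (intro power_decreasing) auto
    then show "p ^ 5 \<le> 1 / 8" using p by simp
  qed (use p_pos in auto)
  finally show ?thesis by simp
qed

end

section \<open>Bounds for the three invariants\<close>

lemma covers_from_gaps:
  assumes "covers_from D A"
  shows "{0<..} - semigroup_span A \<subseteq> {1..D}"
proof -
  have "n \<in> semigroup_span A" if "D < n" for n
    using assms that span_mono[of "A \<inter> {..D}" A] by (auto simp: covers_from_def)
  then show ?thesis by (auto simp: Suc_le_eq) (meson not_less)
qed

lemma covers_from_genus_le:
  assumes "covers_from D A"
  shows "genus (semigroup_span A) \<le> D"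
  using card_mono[OF finite_atLeastAtMost covers_from_gaps[OF assms]] by (simp add: genus_def)

lemma covers_from_frobenius_le:
  assumes "covers_from D A"
  shows "frobenius (semigroup_span A) \<le> int D"
proof -
  have gaps: "{0<..} - semigroup_span A \<subseteq> {1..D}" by (rule covers_from_gaps[OF assms])
  have "Sup ({0<..} - semigroup_span A) \<le> D"
  proof (cases "{0<..} - semigroup_span A = {}")
    case False
    then show ?thesis using gaps by (intro cSup_least) auto
  qed (simp add: Sup_nat_def)
  then show ?thesis by (simp add: frobenius_def)
qed

lemma covers_from_atoms:
  assumes "covers_from D A" "A \<subseteq> {0<..}"
  shows "atoms A \<subseteq> A \<inter> {1..D}"
proof
  fix a assume a: "a \<in> atoms A"
  have "\<not> D < a"
  proof
    assume "D < a"
    then have "A \<inter> {..D} \<subseteq> A \<inter> {..<a}" by auto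
    moreover have "a \<in> semigroup_span (A \<inter> {..D})" using assms(1) \<open>D < a\<close> by (simp add: covers_from_def)
    ultimately have "a \<in> semigroup_span (A \<inter> {..<a})" using span_mono by blast
    then show False using a by (simp add: atoms_def)
  qed
  then show "a \<in> A \<inter> {1..D}" using a assms(2) by (auto simp: atoms_def)
qed

context bernoulli_set
begin

section \<open>From thresholds to expectations\<close>

abbreviation scale :: real where
  "scale \<equiv> 630000 * (1 / p) * (ln (1 / p))\<^sup>2"

text \<open>Failure at every threshold has probability at most \<open>p * (1 / 8) ^ j\<close> for
  all \<open>j\<close>. This gives the almost sure finiteness of the gaps.\<close>

lemma AE_covers_from:
  assumes p: "p \<le> 1 / 10 ^ 11" "1 \<le> ln (1 / p)"
  shows "AE \<omega> in M. \<exists>j. covers_from (threshold j) (random_set \<omega>)"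
proof (rule AE_I)
  let ?N = "\<lambda>j. {\<omega> \<in> space M. \<not> covers_from (threshold j) (random_set \<omega>)}"
  show "{\<omega> \<in> space M. \<not> (\<exists>j. covers_from (threshold j) (random_set \<omega>))} \<subseteq> (\<Inter>j. ?N j)" by auto
  show ev: "(\<Inter>j. ?N j) \<in> events"
    using sets_covers_from by (intro sets.countable_INT) auto
  have "prob (\<Inter>j. ?N j) \<le> p * (1 / 8) ^ j" for j
  proof -
    have "prob (\<Inter>j. ?N j) \<le> prob (?N j)" by (intro finite_measure_mono sets_covers_from) auto
    also have "\<dots> \<le> p * (1 / 8) ^ j" by (rule prob_not_covers_threshold_le[OF p])
    finally show ?thesis .
  qed
  moreover have "(\<lambda>j. p * (1 / 8) ^ j) \<longlonglongrightarrow> p * 0"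
    by (intro tendsto_intros) simp
  ultimately have "prob (\<Inter>j. ?N j) \<le> p * 0"
    by (intro LIMSEQ_le_const) auto
  then have "prob (\<Inter>j. ?N j) = 0" using measure_nonneg[of M "\<Inter>j. ?N j"] by simp
  then show "emeasure M (\<Inter>j. ?N j) = 0" by (simp add: emeasure_eq_measure)
qed

text \<open>Split by the least \<open>j\<close> at which covering holds. For \<open>j = 0\<close>
  use \<open>g\<close>; the value \<open>j + 1\<close> requires failure at \<open>j\<close>, of
  probability at most \<open>p * (1 / 8) ^ j\<close>. The factor \<open>p\<close> allows the crude
  bound \<open>scale\<close> in the tail even when \<open>g\<close> is of the smaller order
  \<open>p * scale\<close>.\<close>

lemma expectation_le_via_thresholds:
  fixes f g :: "(nat \<Rightarrow> bool) \<Rightarrow> real"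
  assumes p: "p \<le> 1 / 10 ^ 11" "1 \<le> ln (1 / p)"
    and f: "f \<in> borel_measurable M" "\<And>\<omega>. 0 \<le> f \<omega>"
      "\<And>\<omega> j. covers_from (threshold j) (random_set \<omega>) \<Longrightarrow> f \<omega> \<le> real (j + 1) ^ 2 * scale"
    and g: "integrable M g" "\<And>\<omega>. 0 \<le> g \<omega>" "\<And>\<omega>. covers_from (threshold 0) (random_set \<omega>) \<Longrightarrow> f \<omega> \<le> g \<omega>"
  shows "integrable M f" "expectation f \<le> expectation g + 8 * (p * scale)"
proof -
  let ?N = "\<lambda>j. {\<omega> \<in> space M. \<not> covers_from (threshold j) (random_set \<omega>)}"
  let ?b = "\<lambda>j. real (j + 2) ^ 2 * scale"
  have scale: "0 \<le> scale" using p_pos by simp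
  have "AE \<omega> in M. ennreal (f \<omega>) \<le> ennreal (g \<omega>) + (\<Sum>j. ennreal (?b j) * indicator (?N j) \<omega>)"
    using AE_covers_from[OF p] AE_space
  proof eventually_elim
    case (elim \<omega>)
    define n where "n = (LEAST j. covers_from (threshold j) (random_set \<omega>))"
    have n: "covers_from (threshold n) (random_set \<omega>)" unfolding n_def using elim(1) by (rule LeastI_ex)
    show ?case
    proof (cases n)
      case 0
      then have "ennreal (f \<omega>) \<le> ennreal (g \<omega>)" using g(3) n by (intro ennreal_leI) auto
      then show ?thesis by (rule order.trans) simp
    next
      case (Suc j)
      have "\<not> covers_from (threshold j) (random_set \<omega>)"
        using not_less_Least[of j "\<lambda>j. covers_from (threshold j) (random_set \<omega>)"] Suc by (simp add: n_def)
      define h where "h i = ennreal (?b i) * indicator (?N i) \<omega>" for i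
      have "indicator (?N j) \<omega> = (1 :: ennreal)"
        using elim \<open>\<not> covers_from (threshold j) (random_set \<omega>)\<close> by simp
      then have "ennreal (f \<omega>) \<le> h j"
        using f(3)[OF n] Suc by (simp add: h_def ennreal_leI)
      also have "h j = sum h {j}" by simp
      also have "\<dots> \<le> (\<Sum>i. h i)" by (rule sum_le_suminf) auto
      finally show ?thesis unfolding h_def by (rule order.trans) simp
    qed
  qed
  then have "(\<integral>\<^sup>+\<omega>. ennreal (f \<omega>) \<partial>M) \<le> (\<integral>\<^sup>+\<omega>. ennreal (g \<omega>) + (\<Sum>j. ennreal (?b j) * indicator (?N j) \<omega>) \<partial>M)"
    by (rule nn_integral_mono_AE)
  also have "\<dots> = (\<integral>\<^sup>+\<omega>. ennreal (g \<omega>) \<partial>M) + (\<integral>\<^sup>+\<omega>. (\<Sum>j. ennreal (?b j) * indicator (?N j) \<omega>) \<partial>M)"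
    using g(1) sets_covers_from by (intro nn_integral_add) auto
  also have "(\<integral>\<^sup>+\<omega>. ennreal (g \<omega>) \<partial>M) = ennreal (expectation g)"
    using g by (intro nn_integral_eq_integral) auto
  also have "(\<integral>\<^sup>+\<omega>. (\<Sum>j. ennreal (?b j) * indicator (?N j) \<omega>) \<partial>M) = (\<Sum>j. ennreal (?b j) * emeasure M (?N j))"
    using sets_covers_from by (subst nn_integral_suminf) (auto simp: nn_integral_cmult_indicator)
  also have "\<dots> \<le> (\<Sum>j. ennreal (4 * (p * scale) * (1 / 2) ^ j))"
  proof (rule suminf_le)
    fix j
    \<comment> \<open>Bounding the squares by powers of 4 leaves a geometric series of ratio
      \<open>4 / 8\<close>, with sum \<open>4 * 2 = 8\<close>.\<close>
    have sq: "real (j + 2) ^ 2 \<le> 4 * 4 ^ j"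
    proof (induction j)
      case (Suc j)
      have "real (Suc j + 2) ^ 2 \<le> 4 * real (j + 2) ^ 2" by (simp add: power2_eq_square algebra_simps)
      also have "\<dots> \<le> 4 * (4 * 4 ^ j)" using Suc by simp
      finally show ?case by simp
    qed simp
    have "?b j * prob (?N j) \<le> (4 * 4 ^ j * scale) * (p * (1 / 8) ^ j)"
      using prob_not_covers_threshold_le[OF p, of j] sq scale p_pos by (intro mult_mono mult_right_mono) auto
    also have "\<dots> = 4 * (p * scale) * (4 ^ j * (1 / 8) ^ j)" by simp
    also have "4 ^ j * (1 / 8) ^ j = (1 / 2 :: real) ^ j" by (simp add: power_mult_distrib[symmetric])
    finally have "ennreal (?b j * prob (?N j)) \<le> ennreal (4 * (p * scale) * (1 / 2) ^ j)"
      by (rule ennreal_leI)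
    moreover have "ennreal (?b j * prob (?N j)) = ennreal (?b j) * emeasure M (?N j)"
      unfolding emeasure_eq_measure by (intro ennreal_mult' mult_nonneg_nonneg scale) simp
    ultimately show "ennreal (?b j) * emeasure M (?N j) \<le> ennreal (4 * (p * scale) * (1 / 2) ^ j)"
      by (simp only:)
  qed auto
  also have "\<dots> = ennreal (8 * (p * scale))"
  proof (rule suminf_ennreal_eq)
    have "(\<lambda>j. 4 * (p * scale) * (1 / 2) ^ j) sums (4 * (p * scale) * (1 / (1 - 1 / 2)))"
      by (intro sums_mult geometric_sums) simp
    then show "(\<lambda>j. 4 * (p * scale) * (1 / 2) ^ j) sums (8 * (p * scale))" by simp
  qed (use scale p_pos in simp)
  also have "ennreal (expectation g) + \<dots> = ennreal (expectation g + 8 * (p * scale))"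
    using g(2) scale p_pos by (intro ennreal_plus[symmetric] integral_nonneg) auto
  finally have le: "(\<integral>\<^sup>+\<omega>. ennreal (f \<omega>) \<partial>M) \<le> ennreal (expectation g + 8 * (p * scale))"
    by (simp add: add_left_mono)
  show "integrable M f"
    using f le by (intro integrableI_nonneg) (auto simp: less_top[symmetric] top_unique)
  then have "ennreal (expectation f) \<le> ennreal (expectation g + 8 * (p * scale))"
    using f le by (subst nn_integral_eq_integral[symmetric]) auto
  moreover have "0 \<le> expectation g + 8 * (p * scale)"
    using g(2) scale p_pos by (intro add_nonneg_nonneg integral_nonneg) auto
  ultimately show "expectation f \<le> expectation g + 8 * (p * scale)" by (simp add: ennreal_le_iff)
qed


lemma measurable_invariants [measurable]:
  "(\<lambda>\<omega>. real (genus (random_semigroup \<omega>))) \<in> borel_measurable M"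
  "(\<lambda>\<omega>. real_of_int (frobenius (random_semigroup \<omega>))) \<in> borel_measurable M"
  "(\<lambda>\<omega>. real (embedding_dim (random_semigroup \<omega>))) \<in> borel_measurable M"
  using measurable_random_semigroup[of "\<lambda>S. real (genus S)" borel]
    measurable_random_semigroup[of "\<lambda>S. real_of_int (frobenius S)" borel]
    measurable_random_semigroup[of "\<lambda>S. real (embedding_dim S)" borel] by simp_all

section \<open>The three invariants for small \<open>p\<close>\<close>

text \<open>The largest \<open>N\<close> that \<open>expectation_card_semigroup_le\<close>
  admits.\<close>

definition lower_range :: nat where
  "lower_range = nat \<lfloor>(ln (1 / p))\<^sup>2 / (128 * p)\<rfloor>"

text \<open>The bound on \<open>p\<close> comes from the constant in
  \<open>prob_not_covers_threshold_le\<close>. The value \<open>3072 = 12 * 256\<close> makes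
  \<open>p * lower_range / 12\<close> at least \<open>ln (1 / p)\<close>.\<close>

context
  assumes p_small: "p \<le> 1 / 10 ^ 11" and ln_large: "3072 \<le> ln (1 / p)"
begin

lemma ln_ge_1: "1 \<le> ln (1 / p)"
  using ln_large by simp

text \<open>Replacing 128 by 256 in the lower bound absorbs the floor. The last bound makes the
  lower tail probability at most \<open>p\<close>.\<close>

lemma lower_range_bounds:
  "real lower_range \<le> (ln (1 / p))\<^sup>2 / (128 * p)"
  "(ln (1 / p))\<^sup>2 / (256 * p) \<le> real lower_range"
  "1 / p \<le> real lower_range"
  "100 \<le> real lower_range"
  "ln (1 / p) \<le> p * lower_range / 12"
proof -
  let ?y = "(ln (1 / p))\<^sup>2 / (256 * p)"
  have "3072 * ln (1 / p) \<le> (ln (1 / p))\<^sup>2"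
    using ln_large by (simp add: power2_eq_square)
  then have "12 * ln (1 / p) / p \<le> ?y" using p_pos by (simp add: field_simps)
  moreover have "1 / p \<le> 12 * ln (1 / p) / p" using p_pos ln_large by (intro divide_right_mono) auto
  moreover have "100 \<le> 1 / p" using p_small p_pos by (simp add: field_simps)
  moreover have *: "(ln (1 / p))\<^sup>2 / (128 * p) = 2 * ?y" by simp
  ultimately have y: "12 * ln (1 / p) / p \<le> ?y" "1 / p \<le> ?y" "100 \<le> ?y" by linarith+
  have "real lower_range \<le> 2 * ?y" "2 * ?y - 1 \<le> real lower_range"
    unfolding lower_range_def * using y(3) by linarith+
  then show "real lower_range \<le> (ln (1 / p))\<^sup>2 / (128 * p)" "?y \<le> real lower_range"
      "1 / p \<le> real lower_range" "100 \<le> real lower_range"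
    using y * by linarith+
  have "12 * ln (1 / p) / p \<le> real lower_range" using y \<open>?y \<le> real lower_range\<close> by linarith
  then show "ln (1 / p) \<le> p * lower_range / 12" using p_pos by (simp add: field_simps)
qed

lemma expectation_card_lower_range:
  "expectation (\<lambda>\<omega>. real (card (random_semigroup \<omega> \<inter> {..lower_range}))) \<le> 2 * p powr (1 / 4) * lower_range"
proof (rule expectation_card_semigroup_le[OF refl])
  have "16 * p / ln (1 / p) \<le> 16 * p / 1" using p_pos p_less_1 ln_ge_1 by (intro divide_left_mono) auto
  then show "16 * p / ln (1 / p) \<le> 1 / 2" using p_small by simp
qed (use lower_range_bounds in auto)

lemma expectation_card_lower_range_half:
  "expectation (\<lambda>\<omega>. real (card (random_semigroup \<omega> \<inter> {..lower_range}))) \<le> 1 / 2 * lower_range"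
proof -
  have "p powr (1 / 4) \<le> (1 / 256) powr (1 / 4)"
    using p_small p_pos by (intro powr_mono2) auto
  also have "(1 / 256) powr (1 / 4) = ((1 / 4) powr 4) powr (1 / 4 :: real)"
    by (simp add: power_divide)
  also have "\<dots> = 1 / 4" by (subst powr_powr) simp
  finally have "2 * p powr (1 / 4) * lower_range \<le> 1 / 2 * lower_range"
    by (intro mult_right_mono) auto
  then show ?thesis using expectation_card_lower_range by linarith
qed

lemma covers_from_threshold_bounds:
  assumes "covers_from (threshold j) (random_set \<omega>)"
  shows "real (genus (random_semigroup \<omega>)) \<le> real (j + 1) ^ 2 * scale"
    and "\<bar>real_of_int (frobenius (random_semigroup \<omega>))\<bar> \<le> real (j + 1) ^ 2 * scale"
    and "embedding_dim (random_semigroup \<omega>) \<le> card (random_set \<omega> \<inter> {1..threshold j})"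
    and "real (embedding_dim (random_semigroup \<omega>)) \<le> real (j + 1) ^ 2 * scale"
proof -
  have le: "real (threshold j) \<le> real (j + 1) ^ 2 * scale" by (rule threshold_le[OF ln_ge_1])
  \<comment> \<open>A positive threshold also bounds the absolute value of the Frobenius number
    -1.\<close>
  have "0 < p * threshold j" using threshold_ge[OF ln_ge_1, of j] ln_ge_1 by linarith
  then have pos: "1 \<le> threshold j" by (cases "threshold j") auto
  show "real (genus (random_semigroup \<omega>)) \<le> real (j + 1) ^ 2 * scale"
    using covers_from_genus_le[OF assms] le unfolding random_semigroup_def by linarith
  show "\<bar>real_of_int (frobenius (random_semigroup \<omega>))\<bar> \<le> real (j + 1) ^ 2 * scale"
    using covers_from_frobenius_le[OF assms] frobenius_ge[of "random_semigroup \<omega>"] le pos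
    unfolding random_semigroup_def by linarith
  show e: "embedding_dim (random_semigroup \<omega>) \<le> card (random_set \<omega> \<inter> {1..threshold j})"
    unfolding embedding_dim_random_semigroup
    by (intro card_mono covers_from_atoms assms random_set_subset) simp
  have "card (random_set \<omega> \<inter> {1..threshold j}) \<le> card {1..threshold j}" by (rule card_mono) auto
  then show "real (embedding_dim (random_semigroup \<omega>)) \<le> real (j + 1) ^ 2 * scale"
    using e le by simp
qed

lemma genus_expectation:
  "integrable M (\<lambda>\<omega>. real (genus (random_semigroup \<omega>)))"
  "expectation (\<lambda>\<omega>. real (genus (random_semigroup \<omega>))) \<le> 9 * scale"
proof -
  note * = expectation_le_via_thresholds[OF p_small ln_ge_1,
      of "\<lambda>\<omega>. real (genus (random_semigroup \<omega>))" "\<lambda>_. scale"]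
  show "integrable M (\<lambda>\<omega>. real (genus (random_semigroup \<omega>)))"
    by (rule *(1)) (use covers_from_threshold_bounds(1) covers_from_threshold_bounds(1)[of 0] p_pos in auto)
  have "expectation (\<lambda>\<omega>. real (genus (random_semigroup \<omega>))) \<le> expectation (\<lambda>_. scale) + 8 * (p * scale)"
    by (rule *(2)) (use covers_from_threshold_bounds(1) covers_from_threshold_bounds(1)[of 0] p_pos in auto)
  also have "p * scale \<le> 1 * scale" using p_pos p_less_1 by (intro mult_right_mono) auto
  finally show "expectation (\<lambda>\<omega>. real (genus (random_semigroup \<omega>))) \<le> 9 * scale" by (simp add: prob_space)
qed

text \<open>The threshold argument needs a nonnegative function, so it is applied to the absolute
  value.\<close>

lemma frobenius_expectation:
  "integrable M (\<lambda>\<omega>. real_of_int (frobenius (random_semigroup \<omega>)))"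
  "expectation (\<lambda>\<omega>. real_of_int (frobenius (random_semigroup \<omega>))) \<le> 9 * scale"
proof -
  let ?F = "\<lambda>\<omega>. real_of_int (frobenius (random_semigroup \<omega>))"
  note * = expectation_le_via_thresholds[OF p_small ln_ge_1, of "\<lambda>\<omega>. \<bar>?F \<omega>\<bar>" "\<lambda>_. scale"]
  have "integrable M (\<lambda>\<omega>. \<bar>?F \<omega>\<bar>)"
    by (rule *(1)) (use covers_from_threshold_bounds(2) covers_from_threshold_bounds(2)[of 0] p_pos in auto)
  then show int: "integrable M ?F" by (subst (asm) integrable_abs_iff) auto
  have "expectation ?F \<le> expectation (\<lambda>\<omega>. \<bar>?F \<omega>\<bar>)"
    using int by (intro integral_mono) auto
  also have "\<dots> \<le> expectation (\<lambda>_. scale) + 8 * (p * scale)"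
    by (rule *(2)) (use covers_from_threshold_bounds(2) covers_from_threshold_bounds(2)[of 0] p_pos in auto)
  also have "p * scale \<le> 1 * scale" using p_pos p_less_1 by (intro mult_right_mono) auto
  finally show "expectation ?F \<le> 9 * scale" by (simp add: prob_space)
qed

text \<open>When the first threshold covers, minimal generators are random elements up to it, of
  expected number \<open>p * threshold 0\<close>. The tail contributes the same order.\<close>

lemma embedding_dim_expectation:
  "integrable M (\<lambda>\<omega>. real (embedding_dim (random_semigroup \<omega>)))"
  "expectation (\<lambda>\<omega>. real (embedding_dim (random_semigroup \<omega>))) \<le> 9 * (p * scale)"
proof -
  let ?e = "\<lambda>\<omega>. real (embedding_dim (random_semigroup \<omega>))"
  let ?g = "\<lambda>\<omega>. real (card (random_set \<omega> \<inter> {1..threshold 0}))"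
  note * = expectation_le_via_thresholds[OF p_small ln_ge_1, of ?e ?g]
  have g: "integrable M ?g" by (rule integrable_local) simp
  show "integrable M ?e"
    by (rule *(1)) (use covers_from_threshold_bounds(3)[of 0] covers_from_threshold_bounds(4) g in auto)
  have "expectation ?e \<le> expectation ?g + 8 * (p * scale)"
    by (rule *(2)) (use covers_from_threshold_bounds(3)[of 0] covers_from_threshold_bounds(4) g in auto)
  also have "expectation ?g = p * real (threshold 0)"
    by (subst expectation_card) auto
  also have "\<dots> \<le> p * scale"
    using threshold_le[OF ln_ge_1, of 0] p_pos by (intro mult_left_mono) auto
  finally show "expectation ?e \<le> 9 * (p * scale)" by simp
qed

text \<open>In expectation at most half of \<open>lower_range\<close> lies in the semigroup, and
  almost surely the gaps are finite, so \<open>genus_ge\<close> applies.\<close>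

lemma genus_expectation_ge: "lower_range / 2 \<le> expectation (\<lambda>\<omega>. real (genus (random_semigroup \<omega>)))"
proof -
  have int: "integrable M (\<lambda>\<omega>. real (card (random_semigroup \<omega> \<inter> {..lower_range})))"
    unfolding random_semigroup_atMost by (rule integrable_local) simp
  have "lower_range - expectation (\<lambda>\<omega>. real (card (random_semigroup \<omega> \<inter> {..lower_range})))
      = expectation (\<lambda>\<omega>. lower_range - real (card (random_semigroup \<omega> \<inter> {..lower_range})))"
    using int by (simp add: prob_space)
  also have "\<dots> \<le> expectation (\<lambda>\<omega>. real (genus (random_semigroup \<omega>)))"
  proof (rule integral_mono_AE)
    show "AE \<omega> in M. lower_range - real (card (random_semigroup \<omega> \<inter> {..lower_range})) \<le> real (genus (random_semigroup \<omega>))"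
      using AE_covers_from[OF p_small ln_ge_1]
    proof eventually_elim
      case (elim \<omega>)
      then have "finite ({0<..} - random_semigroup \<omega>)"
        unfolding random_semigroup_def using covers_from_gaps finite_subset by blast
      then show ?case by (rule genus_ge)
    qed
  qed (use int genus_expectation in auto)
  finally show ?thesis using expectation_card_lower_range_half by linarith
qed

lemma frobenius_expectation_ge:
  "lower_range / 4 \<le> expectation (\<lambda>\<omega>. real_of_int (frobenius (random_semigroup \<omega>)))"
proof -
  have "expectation (\<lambda>\<omega>. real (genus (random_semigroup \<omega>))) - 1
      = expectation (\<lambda>\<omega>. real (genus (random_semigroup \<omega>)) - 1)"
    using genus_expectation by (simp add: prob_space)
  also have "\<dots> \<le> expectation (\<lambda>\<omega>. real_of_int (frobenius (random_semigroup \<omega>)))"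
  proof (rule integral_mono_AE)
    show "AE \<omega> in M. real (genus (random_semigroup \<omega>)) - 1 \<le> real_of_int (frobenius (random_semigroup \<omega>))"
      using AE_covers_from[OF p_small ln_ge_1]
    proof eventually_elim
      case (elim \<omega>)
      then have "finite ({0<..} - random_semigroup \<omega>)"
        unfolding random_semigroup_def using covers_from_gaps finite_subset by blast
      then have "int (genus (random_semigroup \<omega>)) - 1 \<le> frobenius (random_semigroup \<omega>)"
        by (rule frobenius_ge_genus) (simp add: random_semigroup_def)
      then show ?case by linarith
    qed
  qed (use genus_expectation frobenius_expectation in auto)
  \<comment> \<open>The lost 1 is at most a quarter of \<open>lower_range\<close>, which is at least
    100.\<close>
  finally show ?thesis using genus_expectation_ge lower_range_bounds(4) by linarith
qed

lemma integrable_redundant: "integrable M (\<lambda>\<omega>. real (card (redundant N (random_set \<omega>))))"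
  by (subst redundant_local) (rule integrable_local, simp)

text \<open>Of the \<open>p * lower_range\<close> expected elements in the range, at most half are
  expected to be redundant.\<close>

lemma embedding_dim_expectation_ge:
  "p * lower_range / 2 \<le> expectation (\<lambda>\<omega>. real (embedding_dim (random_semigroup \<omega>)))"
proof -
  let ?N = lower_range
  have int: "integrable M (\<lambda>\<omega>. real (card (random_set \<omega> \<inter> {1..?N})))" by (rule integrable_local) simp
  have "p * ?N - expectation (\<lambda>\<omega>. real (card (redundant ?N (random_set \<omega>))))
      = expectation (\<lambda>\<omega>. real (card (random_set \<omega> \<inter> {1..?N})) - real (card (redundant ?N (random_set \<omega>))))"
    by (subst Bochner_Integration.integral_diff[OF int integrable_redundant]) (subst expectation_card, auto)
  also have "\<dots> \<le> expectation (\<lambda>\<omega>. real (embedding_dim (random_semigroup \<omega>)))"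
    by (rule integral_mono) (use int integrable_redundant embedding_dim_expectation in
      \<open>auto simp: embedding_dim_random_semigroup card_atoms_ge[OF random_set_subset, simplified]\<close>)
  finally have "p * ?N - expectation (\<lambda>\<omega>. real (card (redundant ?N (random_set \<omega>))))
    \<le> expectation (\<lambda>\<omega>. real (embedding_dim (random_semigroup \<omega>)))" .
  moreover have "p * expectation (\<lambda>\<omega>. real (card (random_semigroup \<omega> \<inter> {..?N}))) \<le> p * (1 / 2 * ?N)"
    using p_pos by (intro mult_left_mono expectation_card_lower_range_half) auto
  ultimately show ?thesis using expectation_redundant_le[of ?N] by simp
qed

text \<open>Union bound over five bad events: many semigroup elements (\<open>B1\<close>), few
  random elements (\<open>B2\<close>) or many redundant ones (\<open>B3\<close>) in the lower range,
  and no covering (\<open>B4\<close>) or many random elements (\<open>B5\<close>) at the first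
  threshold.\<close>

lemma prob_invariants_ge:
  "1 - (40 * p powr (1 / 4) + 2 * p + p powr (1 / 3)) \<le> prob {\<omega> \<in> space M.
    lower_range / 4 \<le> real (genus (random_semigroup \<omega>)) \<and> real (genus (random_semigroup \<omega>)) \<le> scale \<and>
    lower_range / 4 \<le> real_of_int (frobenius (random_semigroup \<omega>)) \<and>
    real_of_int (frobenius (random_semigroup \<omega>)) \<le> scale \<and>
    p * lower_range / 2 \<le> real (embedding_dim (random_semigroup \<omega>)) \<and>
    real (embedding_dim (random_semigroup \<omega>)) \<le> 2 * (p * scale)}" (is "_ \<le> prob ?G")
proof -
  let ?N = lower_range
  let ?D = "threshold 0"
  define B1 where "B1 = {\<omega> \<in> space M. ?N / 10 \<le> real (card (random_semigroup \<omega> \<inter> {..?N}))}"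
  define B2 where "B2 = {\<omega> \<in> space M. real (card (random_set \<omega> \<inter> {1..?N})) < 3 / 5 * (p * card {1..?N})}"
  define B3 where "B3 = {\<omega> \<in> space M. p * ?N / 10 \<le> real (card (redundant ?N (random_set \<omega>)))}"
  define B4 where "B4 = {\<omega> \<in> space M. \<not> covers_from ?D (random_set \<omega>)}"
  define B5 where "B5 = {\<omega> \<in> space M. real (card (random_set \<omega> \<inter> {1..?D})) > 2 * (p * card {1..?D})}"
  have N: "0 < real ?N" using lower_range_bounds(4) by linarith
  have int: "integrable M (\<lambda>\<omega>. real (card (random_semigroup \<omega> \<inter> {..?N})))"
    unfolding random_semigroup_atMost by (rule integrable_local) simp
  have ev: "B1 \<in> events" "B2 \<in> events" "B3 \<in> events" "B4 \<in> events" "B5 \<in> events"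
  proof -
    show "B1 \<in> events" using int unfolding B1_def by measurable
    show "B3 \<in> events" using integrable_redundant[of ?N] unfolding B3_def by measurable
    show "B4 \<in> events" unfolding B4_def by (rule sets_covers_from)
    show "B2 \<in> events" "B5 \<in> events" unfolding B2_def B5_def by (intro sets_local; simp)+
  qed
  have G: "?G \<in> events" by measurable
  have "space M - ?G \<subseteq> B1 \<union> (B2 \<union> (B3 \<union> (B4 \<union> B5)))"
  proof (rule subsetI, rule ccontr)
    fix \<omega> assume \<omega>: "\<omega> \<in> space M - ?G" and "\<omega> \<notin> B1 \<union> (B2 \<union> (B3 \<union> (B4 \<union> B5)))"
    then have not: "\<omega> \<notin> B1" "\<omega> \<notin> B2" "\<omega> \<notin> B3" "\<omega> \<notin> B4" "\<omega> \<notin> B5" and sp: "\<omega> \<in> space M" by auto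
    have cov: "covers_from ?D (random_set \<omega>)" using not(4) sp by (simp add: B4_def)
    have fin: "finite ({0<..} - random_semigroup \<omega>)"
      unfolding random_semigroup_def using covers_from_gaps[OF cov] finite_subset by blast
    have "real (card (random_semigroup \<omega> \<inter> {..?N})) < ?N / 10" using not(1) sp by (simp add: B1_def)
    then have g: "9 / 10 * ?N \<le> real (genus (random_semigroup \<omega>))" using genus_ge[OF fin, of ?N] by linarith
    have "int (genus (random_semigroup \<omega>)) - 1 \<le> frobenius (random_semigroup \<omega>)"
      by (rule frobenius_ge_genus[OF fin]) (simp add: random_semigroup_def)
    then have "real (genus (random_semigroup \<omega>)) - 1 \<le> real_of_int (frobenius (random_semigroup \<omega>))" by linarith
    then have F: "?N / 4 \<le> real_of_int (frobenius (random_semigroup \<omega>))"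
      using g lower_range_bounds(4) by linarith
    have "3 / 5 * (p * ?N) \<le> real (card (random_set \<omega> \<inter> {1..?N}))" using not(2) sp by (simp add: B2_def)
    moreover have "real (card (redundant ?N (random_set \<omega>))) < p * ?N / 10" using not(3) sp by (simp add: B3_def)
    \<comment> \<open>The constants leave \<open>3 / 5 - 1 / 10 = 1 / 2\<close>.\<close>
    ultimately have e: "p * ?N / 2 \<le> real (embedding_dim (random_semigroup \<omega>))"
      using card_atoms_ge[OF random_set_subset, of \<omega> ?N] unfolding embedding_dim_random_semigroup by linarith
    note ub = covers_from_threshold_bounds[OF cov]
    have "real (card (random_set \<omega> \<inter> {1..?D})) \<le> 2 * (p * ?D)" using not(5) sp by (simp add: B5_def)
    also have "2 * (p * ?D) \<le> 2 * (p * scale)"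
      using threshold_le[OF ln_ge_1, of 0] p_pos by (intro mult_left_mono) auto
    finally have "real (embedding_dim (random_semigroup \<omega>)) \<le> 2 * (p * scale)" using ub(3) by linarith
    moreover have "real (genus (random_semigroup \<omega>)) \<le> scale" using ub(1) by simp
    moreover have "real_of_int (frobenius (random_semigroup \<omega>)) \<le> scale" using ub(2) by simp
    moreover have "?N / 4 \<le> real (genus (random_semigroup \<omega>))" using g N by linarith
    ultimately have "\<omega> \<in> ?G" using e F sp by blast
    then show False using \<omega> by blast
  qed
  then have "prob (space M - ?G) \<le> prob (B1 \<union> (B2 \<union> (B3 \<union> (B4 \<union> B5))))"
    using ev by (intro finite_measure_mono) auto
  also have "\<dots> \<le> prob B1 + (prob B2 + (prob B3 + (prob B4 + prob B5)))"
    using ev by (intro order.trans[OF measure_Un_le] add_left_mono order_refl sets.Un)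
  also have "\<dots> \<le> 20 * p powr (1 / 4) + (p + (20 * p powr (1 / 4) + (p + p powr (1 / 3))))"
  proof (intro add_mono)
    have pw: "exp (- (a * ln (1 / p))) = p powr a" for a
      using p_pos by (simp add: powr_def ln_div)
    have "prob B1 \<le> expectation (\<lambda>\<omega>. real (card (random_semigroup \<omega> \<inter> {..?N}))) / (?N / 10)"
      unfolding B1_def by (rule integral_Markov_inequality_measure[where A = "{}"]) (use int N in auto)
    also have "\<dots> \<le> 2 * p powr (1 / 4) * ?N / (?N / 10)"
      using N by (intro divide_right_mono expectation_card_lower_range) auto
    finally show "prob B1 \<le> 20 * p powr (1 / 4)" using N by simp
    have "prob B2 \<le> exp (- (p * card {1..?N}) / 12)"
      unfolding B2_def by (rule prob_card_lower_tail) auto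
    also have "\<dots> \<le> exp (- (1 * ln (1 / p)))" using lower_range_bounds(5) by simp
    finally show "prob B2 \<le> p" unfolding pw using p_pos by simp
    have "prob B3 \<le> expectation (\<lambda>\<omega>. real (card (redundant ?N (random_set \<omega>)))) / (p * ?N / 10)"
      unfolding B3_def by (rule integral_Markov_inequality_measure[where A = "{}"])
        (use integrable_redundant N p_pos in auto)
    also have "\<dots> \<le> p * (2 * p powr (1 / 4) * ?N) / (p * ?N / 10)"
      using N p_pos by (intro divide_right_mono order.trans[OF expectation_redundant_le]
          mult_left_mono expectation_card_lower_range) auto
    finally show "prob B3 \<le> 20 * p powr (1 / 4)" using N p_pos by simp
    show "prob B4 \<le> p"
      unfolding B4_def using prob_not_covers_threshold_le[OF p_small ln_ge_1, of 0] by simp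
    have "prob B5 \<le> exp (- (p * card {1..?D}) / 3)"
      unfolding B5_def by (rule prob_card_upper_tail) auto
    also have "\<dots> \<le> exp (- (1 / 3 * ln (1 / p)))" using threshold_ge[OF ln_ge_1, of 0] by simp
    finally show "prob B5 \<le> p powr (1 / 3)" unfolding pw .
  qed
  finally have "prob (space M - ?G) \<le> 40 * p powr (1 / 4) + 2 * p + p powr (1 / 3)" by simp
  then show ?thesis using prob_compl[OF G] by linarith
qed

text \<open>Source of the final constants: \<open>1024 = 4 * 256\<close> and
  \<open>9 * 630000 \<le> 10 ^ 7\<close>.\<close>

lemma scale_bounds:
  "1 / 1024 * (1 / p) * (ln (1 / p))\<^sup>2 \<le> lower_range / 4"
  "1 / 1024 * (ln (1 / p))\<^sup>2 \<le> p * lower_range / 2"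
  "9 * scale \<le> 10 ^ 7 * (1 / p) * (ln (1 / p))\<^sup>2"
  "9 * (p * scale) \<le> 10 ^ 7 * (ln (1 / p))\<^sup>2"
  "0 \<le> scale"
proof -
  have "1 / 1024 * (1 / p) * (ln (1 / p))\<^sup>2 = (ln (1 / p))\<^sup>2 / (256 * p) / 4" by simp
  also have "\<dots> \<le> lower_range / 4" by (intro divide_right_mono lower_range_bounds) simp
  finally show "1 / 1024 * (1 / p) * (ln (1 / p))\<^sup>2 \<le> lower_range / 4" .
  have "1 / 1024 * (ln (1 / p))\<^sup>2 \<le> 1 / 512 * (ln (1 / p))\<^sup>2" by simp
  also have "\<dots> = p * ((ln (1 / p))\<^sup>2 / (256 * p)) / 2" using p_pos by simp
  also have "\<dots> \<le> p * lower_range / 2"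
    using p_pos by (intro divide_right_mono mult_left_mono lower_range_bounds) auto
  finally show "1 / 1024 * (ln (1 / p))\<^sup>2 \<le> p * lower_range / 2" .
  show "9 * scale \<le> 10 ^ 7 * (1 / p) * (ln (1 / p))\<^sup>2" "9 * (p * scale) \<le> 10 ^ 7 * (ln (1 / p))\<^sup>2"
    "0 \<le> scale" using p_pos by (simp_all add: divide_right_mono)
qed

lemma expectation_bounds:
  "integrable M (\<lambda>\<omega>. real (genus (random_semigroup \<omega>))) \<and>
   integrable M (\<lambda>\<omega>. real_of_int (frobenius (random_semigroup \<omega>))) \<and>
   integrable M (\<lambda>\<omega>. real (embedding_dim (random_semigroup \<omega>))) \<and>
   1 / 1024 * (1 / p) * (ln (1 / p))\<^sup>2 \<le> expectation (\<lambda>\<omega>. real (genus (random_semigroup \<omega>))) \<and>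
   expectation (\<lambda>\<omega>. real (genus (random_semigroup \<omega>))) \<le> 10 ^ 7 * (1 / p) * (ln (1 / p))\<^sup>2 \<and>
   1 / 1024 * (1 / p) * (ln (1 / p))\<^sup>2 \<le> expectation (\<lambda>\<omega>. real_of_int (frobenius (random_semigroup \<omega>))) \<and>
   expectation (\<lambda>\<omega>. real_of_int (frobenius (random_semigroup \<omega>))) \<le> 10 ^ 7 * (1 / p) * (ln (1 / p))\<^sup>2 \<and>
   1 / 1024 * (ln (1 / p))\<^sup>2 \<le> expectation (\<lambda>\<omega>. real (embedding_dim (random_semigroup \<omega>))) \<and>
   expectation (\<lambda>\<omega>. real (embedding_dim (random_semigroup \<omega>))) \<le> 10 ^ 7 * (ln (1 / p))\<^sup>2"
proof (intro conjI genus_expectation(1) frobenius_expectation(1) embedding_dim_expectation(1))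
  show "1 / 1024 * (1 / p) * (ln (1 / p))\<^sup>2 \<le> expectation (\<lambda>\<omega>. real (genus (random_semigroup \<omega>)))"
    using scale_bounds(1) genus_expectation_ge lower_range_bounds(4) by linarith
qed (rule order.trans[OF _ scale_bounds(3)] order.trans[OF _ scale_bounds(4)]
      order.trans[OF scale_bounds(1)] order.trans[OF scale_bounds(2)],
    rule genus_expectation frobenius_expectation embedding_dim_expectation
      frobenius_expectation_ge embedding_dim_expectation_ge)+

lemma prob_bounds:
  "1 - (40 * p powr (1 / 4) + 2 * p + p powr (1 / 3)) \<le> prob {\<omega> \<in> space M.
    1 / 1024 * (1 / p) * (ln (1 / p))\<^sup>2 \<le> real (genus (random_semigroup \<omega>)) \<and>
    real (genus (random_semigroup \<omega>)) \<le> 10 ^ 7 * (1 / p) * (ln (1 / p))\<^sup>2 \<and>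
    1 / 1024 * (1 / p) * (ln (1 / p))\<^sup>2 \<le> real_of_int (frobenius (random_semigroup \<omega>)) \<and>
    real_of_int (frobenius (random_semigroup \<omega>)) \<le> 10 ^ 7 * (1 / p) * (ln (1 / p))\<^sup>2 \<and>
    1 / 1024 * (ln (1 / p))\<^sup>2 \<le> real (embedding_dim (random_semigroup \<omega>)) \<and>
    real (embedding_dim (random_semigroup \<omega>)) \<le> 10 ^ 7 * (ln (1 / p))\<^sup>2}"
proof (rule order.trans[OF prob_invariants_ge], rule finite_measure_mono, goal_cases)
  case 1
  note sb = scale_bounds
  have "0 \<le> p * scale" using p_pos sb(5) by (rule mult_nonneg_nonneg[OF less_imp_le])
  then have "2 * (p * scale) \<le> 9 * (p * scale)" by (intro mult_right_mono) auto
  then have e: "2 * (p * scale) \<le> 10 ^ 7 * (ln (1 / p))\<^sup>2" using sb(4) by (rule order.trans)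
  have "1 * scale \<le> 9 * scale" using sb(5) by (intro mult_right_mono) auto
  then have g: "scale \<le> 10 ^ 7 * (1 / p) * (ln (1 / p))\<^sup>2" using sb(3) by simp
  show ?case
  proof (rule subsetI, elim CollectE conjE, intro CollectI conjI)
  qed (assumption | erule order.trans[OF sb(1)] order.trans[OF sb(2)] | erule order.trans, rule e | erule order.trans, rule g)+
next
  case 2
  show ?case by measurable
qed

end

end

theorem theorem1p1:
  shows "\<exists>c C p\<^sub>0 :: real. 0 < c \<and> c < C \<and> 0 < p\<^sub>0 \<and> p\<^sub>0 < 1 \<and>
    ((\<lambda>p. measure (bernoulli_space p) {\<omega> \<in> space (bernoulli_space p).
        c * (1 / p) * (ln (1 / p))\<^sup>2 \<le> real (genus (random_semigroup \<omega>)) \<and>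
        real (genus (random_semigroup \<omega>)) \<le> C * (1 / p) * (ln (1 / p))\<^sup>2 \<and>
        c * (1 / p) * (ln (1 / p))\<^sup>2 \<le> real_of_int (frobenius (random_semigroup \<omega>)) \<and>
        real_of_int (frobenius (random_semigroup \<omega>)) \<le> C * (1 / p) * (ln (1 / p))\<^sup>2 \<and>
        c * (ln (1 / p))\<^sup>2 \<le> real (embedding_dim (random_semigroup \<omega>)) \<and>
        real (embedding_dim (random_semigroup \<omega>)) \<le> C * (ln (1 / p))\<^sup>2})
      \<longlongrightarrow> 1) (at_right 0) \<and>
    (\<forall>p. 0 < p \<and> p < p\<^sub>0 \<longrightarrow>
      integrable (bernoulli_space p) (\<lambda>\<omega>. real (genus (random_semigroup \<omega>))) \<and>
      integrable (bernoulli_space p) (\<lambda>\<omega>. real_of_int (frobenius (random_semigroup \<omega>))) \<and>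
      integrable (bernoulli_space p) (\<lambda>\<omega>. real (embedding_dim (random_semigroup \<omega>))) \<and>
      c * (1 / p) * (ln (1 / p))\<^sup>2 \<le> (\<integral>\<omega>. real (genus (random_semigroup \<omega>)) \<partial>bernoulli_space p) \<and>
      (\<integral>\<omega>. real (genus (random_semigroup \<omega>)) \<partial>bernoulli_space p) \<le> C * (1 / p) * (ln (1 / p))\<^sup>2 \<and>
      c * (1 / p) * (ln (1 / p))\<^sup>2 \<le> (\<integral>\<omega>. real_of_int (frobenius (random_semigroup \<omega>)) \<partial>bernoulli_space p) \<and>
      (\<integral>\<omega>. real_of_int (frobenius (random_semigroup \<omega>)) \<partial>bernoulli_space p) \<le> C * (1 / p) * (ln (1 / p))\<^sup>2 \<and>
      c * (ln (1 / p))\<^sup>2 \<le> (\<integral>\<omega>. real (embedding_dim (random_semigroup \<omega>)) \<partial>bernoulli_space p) \<and>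
      (\<integral>\<omega>. real (embedding_dim (random_semigroup \<omega>)) \<partial>bernoulli_space p) \<le> C * (ln (1 / p))\<^sup>2)"
proof -
  have ev: "\<forall>\<^sub>F p in at_right (0 :: real). p \<le> 1 / 10 ^ 11 \<and> 3072 \<le> ln (1 / p)"
    by (intro eventually_conj; real_asymp)
  then obtain b :: real where b: "0 < b" "\<And>p. 0 < p \<Longrightarrow> p < b \<Longrightarrow> p \<le> 1 / 10 ^ 11 \<and> 3072 \<le> ln (1 / p)"
    unfolding eventually_at_right_field by blast
  define p\<^sub>0 where "p\<^sub>0 = min b (1 / 2)"
  have small: "bernoulli_set p" "p \<le> 1 / 10 ^ 11" "3072 \<le> ln (1 / p)" if "0 < p" "p < p\<^sub>0" for p
    using b(2)[of p] that by (auto simp: p\<^sub>0_def bernoulli_set_def)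
  have near: "\<forall>\<^sub>F p in at_right 0. 0 < p \<and> p < p\<^sub>0"
    unfolding eventually_at_right_field using b(1) by (intro exI[of _ p\<^sub>0]) (simp add: p\<^sub>0_def)
  show ?thesis
  proof (intro exI conjI allI impI)
    show "(0 :: real) < 1 / 1024" "1 / 1024 < (10 ^ 7 :: real)" "0 < p\<^sub>0" "p\<^sub>0 < 1"
      using b(1) by (auto simp: p\<^sub>0_def)
    have lim: "((\<lambda>p::real. 1 - (40 * p powr (1 / 4) + 2 * p + p powr (1 / 3))) \<longlongrightarrow> 1) (at_right 0)"
      by real_asymp
    show "((\<lambda>p. measure (bernoulli_space p) {\<omega> \<in> space (bernoulli_space p).
        1 / 1024 * (1 / p) * (ln (1 / p))\<^sup>2 \<le> real (genus (random_semigroup \<omega>)) \<and>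
        real (genus (random_semigroup \<omega>)) \<le> 10 ^ 7 * (1 / p) * (ln (1 / p))\<^sup>2 \<and>
        1 / 1024 * (1 / p) * (ln (1 / p))\<^sup>2 \<le> real_of_int (frobenius (random_semigroup \<omega>)) \<and>
        real_of_int (frobenius (random_semigroup \<omega>)) \<le> 10 ^ 7 * (1 / p) * (ln (1 / p))\<^sup>2 \<and>
        1 / 1024 * (ln (1 / p))\<^sup>2 \<le> real (embedding_dim (random_semigroup \<omega>)) \<and>
        real (embedding_dim (random_semigroup \<omega>)) \<le> 10 ^ 7 * (ln (1 / p))\<^sup>2})
      \<longlongrightarrow> 1) (at_right 0)"
    \<comment> \<open>The lower bound is needed only near 0; the upper bound 1 holds for every real
      \<open>p\<close>.\<close>
    proof (rule tendsto_sandwich[OF _ _ lim tendsto_const], goal_cases)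
      case 1
      show ?case using near
      proof eventually_elim
        case (elim p)
        then show ?case by (intro bernoulli_set.prob_bounds small) auto
      qed
    next
      case 2
      show ?case by (intro always_eventually allI prob_space.prob_le_1 prob_space_bernoulli_space)
    qed
  qed (use bernoulli_set.expectation_bounds[OF small] in blast)+
qed

end
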